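(* Let $\beta,\gamma\in(0,1)$ and $\rho>0$. There exist constants $a_1,a_2,c_1,c_2,c_3>0$, depending only on $\beta,\gamma,\rho$, such that the following holds. Let $\delta\in(0,1)$, $\varepsilon\in(0,1)$, $\alpha\in(0,1)$ with $\alpha<a_1$, $\nu=a_2\varepsilon$, $K=\lceil c_2/(\delta^2\alpha^3)\rceil$, $L=\lceil 2eK\rceil$, and $n\geq c_1/(\delta^5\alpha^9)$. Let $A$ be a deterministic $n\times n$ real matrix with $\|A\|=1$, let $V$ be an $n$-dimensional pattern matrix with parameters $\alpha,\beta,\gamma,\rho$, let $R_1,R_2$ be from the $n$-dimensional oblivious perturbation model with pattern matrix $V$ and parameters $\rho,K,L$, and let $M=A+\varepsilon(R_1+R_2)$. Then $$\mathbb{P}\Big(\inf_{v\in\mathrm{Incomp}(\alpha,\nu)}\|Mv\|_2\geq c_3\,\varepsilon^3\delta^2\alpha^3 n^{-1}\Big)\geq 1-\delta/2.$$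
   Context: $\|\cdot\|$ is the spectral norm, $[n]=\{1,\dots,n\}$, $S^{n-1}$ the unit sphere. Pattern matrix: for $\alpha,\beta,\gamma\in(0,1)$, $\rho>0$, an $n\times n$ matrix $V$ with entries in $\{-1,1\}$ with (i) $\|V\|\leq\rho\sqrt n$ and (ii) for every $\eta\in\{-1,1\}^n$ and every $x\in S^{n-1}$ with at most $\alpha n$ nonzero coordinates, $|\{j:|e_j^\top V\mathrm{diag}(\eta)x|\geq\beta\}|\geq\gamma n$ and $|\{j:|e_j^\top V^\top\mathrm{diag}(\eta)x|\geq\beta\}|\geq\gamma n$. Oblivious perturbation model (mutually independent random objects): $\eta_{k,i}$ ($k=1,2$, $i\in[n]$) i.i.d. Rademacher, $D_k=\mathrm{diag}(\eta_{k,1},\dots,\eta_{k,n})$, $R_1=(\rho\sqrt n)^{-1}D_1VD_2$; $J_1,\dots,J_n$ independent uniformly random $K$-subsets of $[n]$; $\bar h_{j,i}=\mathbf 1[j\in J_i]$; $H$ is $\bar H$ with each row having more than $L$ nonzeros replaced by zero; $X_{l,i}$ ($l\in[K],i\in[n]$) i.i.d. Rademacher; with $J_i=\{j(i,1)<\dots<j(i,K)\}$, $\bar R_2$ has entry $X_{l,i}/L$ at $(j(i,l),i)$ and $0$ elsewhere; $R_2=H\odot\bar R_2$ (entrywise product). $\mathrm{Comp}(\alpha,\nu)$ is the set of $x\in S^{n-1}$ within Euclidean distance $\nu$ of some $v\in S^{n-1}$ with at most $\alpha n$ nonzero coordinates, and $\mathrm{Incomp}(\alpha,\nu)=S^{n-1}\setminus\mathrm{Comp}(\alpha,\nu)$.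 *)

theory Defs
  imports
    "HOL-Probability.Probability"
    "Jordan_Normal_Form.Matrix"
begin

unbundle no vec_syntax

text \<open>
  The dimension is quantified inside the main statement, so vectors and matrices are those of
  \<^theory>\<open>Jordan_Normal_Form.Matrix\<close>, with index set \<open>{..<n}\<close> for \<open>[n]\<close>.
\<close>

definition l2_norm :: "real Matrix.vec \<Rightarrow> real" where
  "l2_norm x = sqrt (x \<bullet> x)"

definition unit_sphere :: "nat \<Rightarrow> real Matrix.vec set" where
  "unit_sphere n = {x \<in> carrier_vec n. l2_norm x = 1}"

definition spectral_norm :: "real Matrix.mat \<Rightarrow> real" where
  "spectral_norm A = (SUP x \<in> unit_sphere (dim_col A). l2_norm (A *\<^sub>v x))"

definition num_nonzero :: "real Matrix.vec \<Rightarrow> nat" where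
  "num_nonzero x = card {i. i < dim_vec x \<and> x $ i \<noteq> 0}"

definition Comp :: "nat \<Rightarrow> real \<Rightarrow> real \<Rightarrow> real Matrix.vec set" where
  "Comp n \<alpha> \<nu> = {x \<in> unit_sphere n.
     \<exists>v \<in> unit_sphere n. real (num_nonzero v) \<le> \<alpha> * real n \<and> l2_norm (x - v) \<le> \<nu>}"

definition Incomp :: "nat \<Rightarrow> real \<Rightarrow> real \<Rightarrow> real Matrix.vec set" where
  "Incomp n \<alpha> \<nu> = unit_sphere n - Comp n \<alpha> \<nu>"

definition pattern_matrix ::
  "nat \<Rightarrow> real \<Rightarrow> real \<Rightarrow> real \<Rightarrow> real \<Rightarrow> real Matrix.mat \<Rightarrow> bool" where
  "pattern_matrix n \<alpha> \<beta> \<gamma> \<rho> V \<longleftrightarrow>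
     V \<in> carrier_mat n n \<and>
     (\<forall>i<n. \<forall>j<n. V $$ (i, j) \<in> {-1, 1}) \<and>
     spectral_norm V \<le> \<rho> * sqrt (real n) \<and>
     (\<forall>\<eta> \<in> {..<n} \<rightarrow> {-1, 1}. \<forall>x \<in> unit_sphere n. real (num_nonzero x) \<le> \<alpha> * real n \<longrightarrow>
        real (card {j. j < n \<and> \<bar>(V * mat_diag n \<eta> *\<^sub>v x) $ j\<bar> \<ge> \<beta>}) \<ge> \<gamma> * real n \<and>
        real (card {j. j < n \<and> \<bar>(transpose_mat V * mat_diag n \<eta> *\<^sub>v x) $ j\<bar> \<ge> \<beta>}) \<ge> \<gamma> * real n)"

definition rademacher :: "real pmf" where
  "rademacher = pmf_of_set {-1, 1}"

text \<open>
  Joint law of the random inputs \<open>(\<eta>, J, X)\<close> of the oblivious perturbation model; mutual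
  independence is expressed by products of probability mass functions. All the random objects
  are functions of these inputs. The law is meaningful only for \<open>K \<le> n\<close>, since otherwise there
  are no \<open>K\<close>-subsets of \<open>{..<n}\<close>.
\<close>

type_synonym perturbation_input =
  "(nat \<times> nat \<Rightarrow> real) \<times> (nat \<Rightarrow> nat set) \<times> (nat \<times> nat \<Rightarrow> real)"

definition perturbation_law :: "nat \<Rightarrow> nat \<Rightarrow> perturbation_input pmf" where
  "perturbation_law n K =
     pair_pmf (Pi_pmf ({1, 2} \<times> {..<n}) 0 (\<lambda>_. rademacher))
       (pair_pmf (Pi_pmf {..<n} {} (\<lambda>_. pmf_of_set {S. S \<subseteq> {..<n} \<and> card S = K}))
         (Pi_pmf ({..<K} \<times> {..<n}) 0 (\<lambda>_. rademacher)))"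

definition R1 :: "nat \<Rightarrow> real \<Rightarrow> real Matrix.mat \<Rightarrow> perturbation_input \<Rightarrow> real Matrix.mat" where
  "R1 n \<rho> V = (\<lambda>(\<eta>, J, X).
     (1 / (\<rho> * sqrt (real n))) \<cdot>\<^sub>m
       (mat_diag n (\<lambda>i. \<eta> (1, i)) * V * mat_diag n (\<lambda>i. \<eta> (2, i))))"

definition H_bar :: "nat \<Rightarrow> (nat \<Rightarrow> nat set) \<Rightarrow> real Matrix.mat" where
  "H_bar n J = Matrix.mat n n (\<lambda>(j, i). if j \<in> J i then 1 else 0)"

definition H_trunc :: "nat \<Rightarrow> nat \<Rightarrow> (nat \<Rightarrow> nat set) \<Rightarrow> real Matrix.mat" where
  "H_trunc n L J = Matrix.mat n n (\<lambda>(j, i).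
     if num_nonzero (row (H_bar n J) j) > L then 0 else H_bar n J $$ (j, i))"

text \<open>
  \<open>sorted_list_of_set (J i) ! l\<close> is the \<open>l\<close>-th smallest element of \<open>J i\<close>, counting from \<open>0\<close>.
  At most one summand is nonzero when \<open>J i\<close> has \<open>K\<close> elements.
\<close>

definition R2_bar ::
  "nat \<Rightarrow> nat \<Rightarrow> nat \<Rightarrow> (nat \<Rightarrow> nat set) \<Rightarrow> (nat \<times> nat \<Rightarrow> real) \<Rightarrow> real Matrix.mat" where
  "R2_bar n K L J X = Matrix.mat n n (\<lambda>(j, i).
     \<Sum>l<K. if j = sorted_list_of_set (J i) ! l then X (l, i) / real L else 0)"

definition hadamard_prod :: "real Matrix.mat \<Rightarrow> real Matrix.mat \<Rightarrow> real Matrix.mat" where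
  "hadamard_prod A B = Matrix.mat (dim_row A) (dim_col A) (\<lambda>(j, i). A $$ (j, i) * B $$ (j, i))"

definition R2 :: "nat \<Rightarrow> nat \<Rightarrow> nat \<Rightarrow> perturbation_input \<Rightarrow> real Matrix.mat" where
  "R2 n K L = (\<lambda>(\<eta>, J, X). hadamard_prod (H_trunc n L J) (R2_bar n K L J X))"

end

theory Submission
  imports Defs "Jordan_Normal_Form.Determinant"
begin

unbundle no inner_syntax

text \<open>
  Let \<open>u\<^sub>i\<close> be a unit vector orthogonal to all columns of \<open>M\<close> but the \<open>i\<close>-th. Then
  \<open>\<parallel>M v\<parallel> \<ge> \<bar>v\<^sub>i\<bar> \<bar>\<langle>M\<^sub>i, u\<^sub>i\<rangle>\<bar>\<close>, and an incompressible \<open>v\<close> has more than \<open>\<alpha> n\<close> coordinates of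
  order \<open>\<epsilon> / \<surd>n\<close>. So if \<open>\<parallel>M v\<parallel>\<close> is small, then more than \<open>\<alpha> n\<close> of the \<open>\<langle>M\<^sub>i, u\<^sub>i\<rangle>\<close> are small, and
  by Markov's inequality it suffices to bound the probability of this for a single \<open>i\<close> by a small
  multiple of \<open>\<delta> \<alpha>\<close>. If \<open>u\<^sub>i\<close> has order \<open>\<alpha> n\<close> large coordinates in rows that survive the
  truncation, then order \<open>\<alpha> K\<close> of them lie in \<open>J\<^sub>i\<close> by Chebyshev's inequality, and the
  Littlewood--Offord inequality for the signs \<open>X\<close> gives a bound of order \<open>1 / \<surd>(\<alpha> K)\<close>. Few rows are
  truncated because \<open>L \<ge> 2 e K\<close>.

  It remains to see that \<open>u\<^sub>i\<close> is incompressible, which follows if \<open>M\<^sup>T u\<close> has many coordinates of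
  order \<open>\<epsilon> / \<surd>n\<close> for all sparse unit vectors \<open>u\<close> simultaneously. For a fixed \<open>u\<close> this holds because
  the \<open>i\<close>-th coordinate cancels for at most one value of the sign \<open>\<eta>\<^sub>2\<^sub>,\<^sub>i\<close>. A net over \<open>u\<close> would
  cost a power of \<open>1 / \<epsilon>\<close>; instead, the cancelling signs depend only on the signs of affine
  functionals of \<open>u\<close>, whose number of patterns is bounded by the Sauer--Shelah lemma independently
  of \<open>\<epsilon>\<close>.
\<close>

subsection \<open>Conditioning in product distributions\<close>

lemma prob_pair_pmf_le_fst:
  assumes "\<And>x. x \<in> set_pmf p \<Longrightarrow> measure_pmf.prob q {y. (x, y) \<in> E} \<le> c" and "0 \<le> c"
  shows "measure_pmf.prob (pair_pmf p q) E \<le> c"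
proof -
  have "emeasure (pair_pmf p q) E = (\<integral>\<^sup>+x. \<integral>\<^sup>+y. indicator E (x, y) \<partial>q \<partial>p)"
    by (simp flip: nn_integral_pair_pmf')
  also have "\<dots> = (\<integral>\<^sup>+x. emeasure q {y. (x, y) \<in> E} \<partial>p)"
    by (intro nn_integral_cong) (simp flip: nn_integral_indicator add: indicator_def)
  also have "\<dots> \<le> (\<integral>\<^sup>+x. ennreal c \<partial>p)"
    using assms(1)
    by (intro nn_integral_mono_AE)
      (auto simp: AE_measure_pmf_iff measure_pmf.emeasure_eq_measure intro!: ennreal_leI)
  finally show ?thesis
    using assms(2) by (simp add: measure_pmf.emeasure_eq_measure ennreal_le_iff)
qed

lemma prob_pair_pmf_le_snd:
  assumes "\<And>y. y \<in> set_pmf q \<Longrightarrow> measure_pmf.prob p {x. (x, y) \<in> E} \<le> c" and "0 \<le> c"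
  shows "measure_pmf.prob (pair_pmf p q) E \<le> c"
  unfolding pair_commute_pmf[of p q] measure_map_pmf
  by (rule prob_pair_pmf_le_fst) (use assms in \<open>auto simp: vimage_def\<close>)

lemma Pi_pmf_override_on:
  assumes "finite A" "B \<subseteq> A"
  shows "Pi_pmf A d p =
    map_pmf (\<lambda>(f, g). override_on f g B) (pair_pmf (Pi_pmf (A - B) d p) (Pi_pmf B d p))"
proof -
  have "Pi_pmf (B \<union> (A - B)) d p = map_pmf (\<lambda>(g, f) x. if x \<in> B then g x else f x)
      (pair_pmf (Pi_pmf B d p) (Pi_pmf (A - B) d p))"
    using assms by (intro Pi_pmf_union) (auto intro: finite_subset)
  moreover have "B \<union> (A - B) = A" using assms(2) by blast
  ultimately show ?thesis
    by (simp add: pair_commute_pmf[of "Pi_pmf B d p"] map_pmf_comp case_prod_unfold override_on_def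
        cong: if_cong)
qed

lemma prob_Pi_pmf_override_le:
  assumes "finite A" "B \<subseteq> A"
    and "\<And>f. f \<in> set_pmf (Pi_pmf (A - B) d p) \<Longrightarrow>
      measure_pmf.prob (Pi_pmf B d p) {g. override_on f g B \<in> E} \<le> c"
    and "0 \<le> c"
  shows "measure_pmf.prob (Pi_pmf A d p) E \<le> c"
  unfolding Pi_pmf_override_on[OF assms(1,2)] measure_map_pmf
  by (rule prob_pair_pmf_le_fst) (use assms in \<open>auto simp: vimage_def\<close>)

lemma pair_pmf_exchange:
  "pair_pmf (pair_pmf p p') (pair_pmf q q') =
    map_pmf (\<lambda>((x, y), (x', y')). ((x, x'), (y, y'))) (pair_pmf (pair_pmf p q) (pair_pmf p' q'))"
  unfolding pair_pmf_def map_pmf_def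
  by (simp add: bind_assoc_pmf bind_return_pmf bind_commute_pmf[of p' q])

lemma prob_pair_Pi_pmf_override_le:
  assumes "finite A" "A' \<subseteq> A" "finite B" "B' \<subseteq> B"
    and "\<And>f g. measure_pmf.prob (pair_pmf (Pi_pmf A' d p) (Pi_pmf B' e q))
      {(f', g'). (override_on f f' A', override_on g g' B') \<in> E} \<le> c"
    and "0 \<le> c"
  shows "measure_pmf.prob (pair_pmf (Pi_pmf A d p) (Pi_pmf B e q)) E \<le> c"
  unfolding Pi_pmf_override_on[OF assms(1,2)] Pi_pmf_override_on[OF assms(3,4)]
    map_pair[symmetric] measure_map_pmf
proof (subst pair_pmf_exchange, unfold measure_map_pmf, rule prob_pair_pmf_le_fst, goal_cases)
  case (1 x)
  show ?case using assms(5)[of "fst x" "snd x"] by (simp add: vimage_def case_prod_unfold)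
qed (rule assms(6))

lemma measure_pmf_Markov:
  assumes "integrable (measure_pmf p) f" "\<And>x. 0 \<le> (f x :: real)" "0 < c"
  shows "measure_pmf.prob p {x. c \<le> f x} \<le> measure_pmf.expectation p f / c"
  using integral_Markov_inequality_measure[of "measure_pmf p" f "{}" c] assms by simp

lemma prob_many_events_le:
  assumes "finite I" "\<And>i. i \<in> I \<Longrightarrow> measure_pmf.prob p {x. Q i x} \<le> c" "0 < t"
  shows "measure_pmf.prob p {x. t \<le> real (card {i \<in> I. Q i x})} \<le> real (card I) * c / t"
proof -
  have card: "real (card {i \<in> I. Q i x}) = (\<Sum>i\<in>I. indicat_real {x. Q i x} x)" for x
    using assms(1) by (simp add: indicator_def Int_def)
  have integrable: "integrable (measure_pmf p) (indicat_real {x. Q i x})" for i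
    by (rule measure_pmf.integrable_const_bound[where B = 1]) auto
  have "measure_pmf.prob p {x. t \<le> real (card {i \<in> I. Q i x})}
      \<le> measure_pmf.expectation p (\<lambda>x. \<Sum>i\<in>I. indicat_real {x. Q i x} x) / t"
    unfolding card
    by (rule measure_pmf_Markov) (use assms(3) integrable in \<open>auto intro!: sum_nonneg\<close>)
  also have "measure_pmf.expectation p (\<lambda>x. \<Sum>i\<in>I. indicat_real {x. Q i x} x)
      = (\<Sum>i\<in>I. measure_pmf.prob p {x. Q i x})"
    using integrable by (subst Bochner_Integration.integral_sum) auto
  also have "\<dots> \<le> real (card I) * c"
    using assms(2) by (intro sum_bounded_above) auto
  finally show ?thesis using assms(3) by (simp add: divide_right_mono)
qed

subsection \<open>Littlewood--Offord anticoncentration\<close>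

text \<open>The mass of the \<open>k\<close> middle binomial probabilities is the probability that a simple random
  walk started at \<open>k\<close> stays positive for \<open>m\<close> steps, and satisfies that walk's recursion.\<close>

definition binomial_mass :: "nat \<Rightarrow> int \<Rightarrow> real" where
  "binomial_mass m j = (if j < 0 then 0 else real (m choose nat j) / 2 ^ m)"

definition middle_indices :: "nat \<Rightarrow> nat \<Rightarrow> int set" where
  "middle_indices m k = {j. int m - int k < 2 * j \<and> 2 * j \<le> int m + int k}"

definition middle_mass :: "nat \<Rightarrow> nat \<Rightarrow> real" where
  "middle_mass m k = (\<Sum>j\<in>middle_indices m k. binomial_mass m j)"

lemma binomial_mass_Suc:
  "binomial_mass (Suc m) j = (binomial_mass m j + binomial_mass m (j - 1)) / 2"
proof -
  consider "j < 0" | "j = 0" | i where "j = int (Suc i)"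
    by (metis int_cases nat.exhaust negative_zless_0 of_nat_0)
  then show ?thesis
  proof cases
    case 3
    then have "nat j = Suc i" "nat (j - 1) = i" "\<not> j < 0" "\<not> j - 1 < 0" by auto
    then show ?thesis by (simp add: binomial_mass_def field_simps)
  qed (auto simp: binomial_mass_def)
qed

lemma finite_middle_indices [simp]: "finite (middle_indices m k)"
  by (rule finite_subset[of _ "{- int m - int k .. int m + int k}"])
    (auto simp: middle_indices_def)

lemma middle_mass_0_right [simp]: "middle_mass m 0 = 0"
proof -
  have "middle_indices m 0 = {}" by (auto simp: middle_indices_def)
  then show ?thesis by (simp add: middle_mass_def)
qed

lemma middle_mass_0_left: "1 \<le> middle_mass 0 (Suc k)"
proof -
  have "0 \<in> middle_indices 0 (Suc k)" by (simp add: middle_indices_def)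
  then have "binomial_mass 0 0 \<le> middle_mass 0 (Suc k)"
    unfolding middle_mass_def by (intro member_le_sum) (auto simp: binomial_mass_def)
  then show ?thesis by (simp add: binomial_mass_def)
qed

lemma middle_mass_Suc:
  "middle_mass (Suc m) (Suc k) = (middle_mass m (Suc (Suc k)) + middle_mass m k) / 2"
proof -
  define S where "S = middle_indices (Suc m) (Suc k)"
  define T where "T = (\<lambda>j. j - 1) ` S"
  have T: "T = {j. j + 1 \<in> S}" by (force simp: T_def)
  have fin: "finite S" "finite T" by (simp_all add: S_def T_def)
  have parts: "S \<union> T = middle_indices m (Suc (Suc k))" "S \<inter> T = middle_indices m k"
    unfolding T S_def middle_indices_def by auto
  have "middle_mass (Suc m) (Suc k) = (\<Sum>j\<in>S. (binomial_mass m j + binomial_mass m (j - 1)) / 2)"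
    unfolding middle_mass_def S_def by (simp add: binomial_mass_Suc)
  also have "\<dots> = ((\<Sum>j\<in>S. binomial_mass m j) + (\<Sum>j\<in>T. binomial_mass m j)) / 2"
    unfolding T_def
    by (subst sum.reindex) (auto simp: inj_on_def sum.distrib sum_divide_distrib[symmetric])
  also have "(\<Sum>j\<in>S. binomial_mass m j) + (\<Sum>j\<in>T. binomial_mass m j)
      = middle_mass m (Suc (Suc k)) + middle_mass m k"
    unfolding middle_mass_def using sum.union_inter[OF fin, of "binomial_mass m"] parts by simp
  finally show ?thesis .
qed

lemma Suc_times_central_binomial:
  "Suc n * ((2 * Suc n) choose Suc n) = 2 * ((2 * n + 1) * ((2 * n) choose n))"
proof -
  have "Suc n * ((2 * Suc n) choose Suc n) = 2 * (Suc n * ((2 * n + 1) choose n))"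
    using Suc_times_binomial[of n "2 * n + 1"] by simp
  also have "(2 * n + 1) choose n = (2 * n + 1) choose Suc n"
    using binomial_symmetric[of n "2 * n + 1"] by simp
  also have "Suc n * ((2 * n + 1) choose Suc n) = (2 * n + 1) * ((2 * n) choose n)"
    using Suc_times_binomial[of n "2 * n"] by simp
  finally show ?thesis .
qed

lemma central_binomial_upper_bound: "real ((2 * n) choose n) / 4 ^ n \<le> 1 / sqrt (2 * real n + 1)"
proof (induction n)
  case (Suc n)
  have "(real n + 1) * real ((2 * Suc n) choose Suc n)
      = 2 * ((2 * real n + 1) * real ((2 * n) choose n))"
    using arg_cong[OF Suc_times_central_binomial[of n], of real]
    unfolding of_nat_mult by (simp add: add.commute)
  then have "real ((2 * Suc n) choose Suc n) / 4 ^ Suc n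
      = (2 * real n + 1) / (2 * real n + 2) * (real ((2 * n) choose n) / 4 ^ n)"
    by (simp add: divide_simps del: binomial_Suc_Suc mult_Suc_right) (simp add: algebra_simps)
  also have "\<dots> \<le> (2 * real n + 1) / (2 * real n + 2) * (1 / sqrt (2 * real n + 1))"
    by (rule mult_left_mono[OF Suc.IH]) simp
  also have "\<dots> = sqrt (2 * real n + 1) / (2 * real n + 2)"
    by (simp add: real_div_sqrt field_simps)
  also have "\<dots> \<le> 1 / sqrt (2 * real (Suc n) + 1)"
  proof -
    have "sqrt (2 * real n + 1) * sqrt (2 * real n + 3) \<le> 2 * real n + 2"
      unfolding real_sqrt_mult[symmetric]
      by (rule real_le_lsqrt) (auto simp: power2_eq_square algebra_simps)
    then show ?thesis by (simp add: field_simps)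
  qed
  finally show ?case .
qed simp

lemma middle_mass_1_le: "middle_mass m 1 \<le> 1 / sqrt (real m + 1)"
proof (cases "even m")
  case True
  then obtain h where m: "m = 2 * h" by auto
  have "middle_indices m 1 = {int h}" by (auto simp: middle_indices_def m)
  then have "middle_mass m 1 = real ((2 * h) choose h) / 4 ^ h"
    by (simp add: middle_mass_def binomial_mass_def m power_mult)
  then show ?thesis using central_binomial_upper_bound[of h] by (simp add: m)
next
  case False
  then obtain h where m: "m = 2 * h + 1" by (auto elim: oddE)
  have "middle_indices m 1 = {int (Suc h)}" by (auto simp: middle_indices_def m)
  then have "middle_mass m 1 = real ((2 * h + 1) choose Suc h) / 2 ^ (2 * h + 1)"
    by (simp add: middle_mass_def binomial_mass_def m nat_add_distrib)
  also have "\<dots> = real ((2 * Suc h) choose Suc h) / 4 ^ Suc h"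
    using binomial_symmetric[of h "2 * h + 1"]
    by (simp add: power_mult add_divide_distrib)
  also have "\<dots> \<le> 1 / sqrt (2 * real (Suc h) + 1)" by (rule central_binomial_upper_bound)
  also have "\<dots> \<le> 1 / sqrt (real m + 1)"
    by (intro divide_left_mono) (auto simp: m)
  finally show ?thesis .
qed

lemma set_pmf_rademacher [simp]: "set_pmf rademacher = {-1, 1}"
  by (simp add: rademacher_def)

abbreviation rademacher_signs :: "'a set \<Rightarrow> ('a \<Rightarrow> real) pmf" where
  "rademacher_signs A \<equiv> Pi_pmf A 0 (\<lambda>_. rademacher)"

definition rademacher_sum :: "'a set \<Rightarrow> ('a \<Rightarrow> real) \<Rightarrow> real pmf" where
  "rademacher_sum A a = map_pmf (\<lambda>X. \<Sum>l\<in>A. a l * X l) (rademacher_signs A)"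

lemma rademacher_sum_insert:
  assumes "finite A" "x \<notin> A"
  shows "rademacher_sum (insert x A) a =
    bind_pmf rademacher (\<lambda>\<sigma>. map_pmf (\<lambda>y. a x * \<sigma> + y) (rademacher_sum A a))"
proof -
  have "(\<Sum>l\<in>insert x A. a l * (X(x := \<sigma>)) l) = a x * \<sigma> + (\<Sum>l\<in>A. a l * X l)"
    for X :: "'a \<Rightarrow> real" and \<sigma>
    using assms by (auto intro!: sum.cong)
  then show ?thesis
    unfolding rademacher_sum_def Pi_pmf_insert'[OF assms] map_pmf_def
    by (simp add: bind_assoc_pmf bind_return_pmf del: fun_upd_apply)
qed

lemma prob_bind_rademacher:
  "measure_pmf.prob (bind_pmf rademacher f) E
    = (measure_pmf.prob (f 1) E + measure_pmf.prob (f (-1)) E) / 2"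
proof -
  have "ennreal (measure_pmf.prob (bind_pmf rademacher f) E) = (\<integral>\<^sup>+\<sigma>. emeasure (f \<sigma>) E \<partial>rademacher)"
    by (simp flip: measure_pmf.emeasure_eq_measure)
  also have "\<dots> = (emeasure (f 1) E + emeasure (f (-1)) E) / 2"
    by (simp add: rademacher_def nn_integral_pmf_of_set add.commute)
  also have "\<dots> = ennreal ((measure_pmf.prob (f 1) E + measure_pmf.prob (f (-1)) E) / 2)"
    by (simp add: measure_pmf.emeasure_eq_measure divide_ennreal flip: ennreal_plus ennreal_numeral)
  finally show ?thesis by (simp add: ennreal_inj)
qed

definition windows :: "real \<Rightarrow> (nat \<Rightarrow> real) \<Rightarrow> nat \<Rightarrow> real set" where
  "windows r t k = (\<Union>s<k. {t s..<t s + 2 * r})"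

definition spaced :: "real \<Rightarrow> (nat \<Rightarrow> real) \<Rightarrow> nat \<Rightarrow> bool" where
  "spaced r t k \<longleftrightarrow> (\<forall>s. Suc s < k \<longrightarrow> t s + 2 * r \<le> t (Suc s))"

lemma spaced_le_last:
  assumes "spaced r t (Suc k)" "0 \<le> r" "s \<le> k"
  shows "t s \<le> t k"
  using \<open>s \<le> k\<close>
proof (induction rule: inc_induct)
  case (step i)
  then show ?case using assms(1,2) by (force simp: spaced_def)
qed simp

lemma translate_windows: "{y. c + y \<in> windows r t k} = windows r (\<lambda>s. t s - c) k"
  by (auto simp: windows_def algebra_simps)

lemma prob_rademacher_sum_insert_windows:
  assumes "finite A" "x \<notin> A"
  shows "measure_pmf.prob (rademacher_sum (insert x A) a) (windows r t k) =
    (measure_pmf.prob (rademacher_sum A a) (windows r (\<lambda>s. t s - \<bar>a x\<bar>) k) +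
     measure_pmf.prob (rademacher_sum A a) (windows r (\<lambda>s. t s + \<bar>a x\<bar>) k)) / 2"
  by (cases "0 \<le> a x")
    (simp_all add: rademacher_sum_insert[OF assms] prob_bind_rademacher vimage_def translate_windows
      translate_windows[of "- a x", simplified])

text \<open>Kleitman's exchange: the windows shifted down and up by \<open>b\<close> are at least their width apart,
  so the last upper window can be moved to the lower windows.\<close>

lemma prob_windows_exchange:
  assumes "spaced r t (Suc k)" "0 < r" "r \<le> b"
  shows "measure_pmf.prob p (windows r (\<lambda>s. t s - b) (Suc k)) +
      measure_pmf.prob p (windows r (\<lambda>s. t s + b) (Suc k))
    \<le> measure_pmf.prob p (windows r ((\<lambda>s. t s - b)(Suc k := t k + b)) (Suc (Suc k))) +
      measure_pmf.prob p (windows r (\<lambda>s. t s + b) k)"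
proof -
  define N where "N = {t k + b..<t k + b + 2 * r}"
  have "t s - b + 2 * r \<le> t k + b" if "s < Suc k" for s
    using spaced_le_last[OF assms(1), of s] assms(2,3) that by simp
  then have "windows r (\<lambda>s. t s - b) (Suc k) \<inter> N = {}"
    by (force simp: windows_def N_def)
  moreover have "windows r ((\<lambda>s. t s - b)(Suc k := t k + b)) (Suc (Suc k))
      = windows r (\<lambda>s. t s - b) (Suc k) \<union> N"
    by (auto simp: windows_def N_def lessThan_Suc)
  ultimately have "measure_pmf.prob p (windows r ((\<lambda>s. t s - b)(Suc k := t k + b)) (Suc (Suc k)))
      = measure_pmf.prob p (windows r (\<lambda>s. t s - b) (Suc k)) + measure_pmf.prob p N"
    by (simp add: measure_pmf.finite_measure_Union)
  moreover have "windows r (\<lambda>s. t s + b) (Suc k) = windows r (\<lambda>s. t s + b) k \<union> N"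
    by (auto simp: windows_def N_def lessThan_Suc)
  then have "measure_pmf.prob p (windows r (\<lambda>s. t s + b) (Suc k))
      \<le> measure_pmf.prob p (windows r (\<lambda>s. t s + b) k) + measure_pmf.prob p N"
    by (simp add: measure_Un_le)
  ultimately show ?thesis by linarith
qed

lemma spaced_exchange:
  assumes "spaced r t (Suc k)" "r \<le> b"
  shows "spaced r ((\<lambda>s. t s - b)(Suc k := t k + b)) (Suc (Suc k))"
  using assms by (auto simp: spaced_def less_Suc_eq)

lemma spaced_shift:
  assumes "spaced r t k"
  shows "spaced r (\<lambda>s. t s - b) k" "spaced r (\<lambda>s. t s + b) k"
  using assms by (auto simp: spaced_def)

lemma prob_shifted_windows_le:
  assumes "\<And>t k. spaced r t k \<Longrightarrow> measure_pmf.prob p (windows r t k) \<le> middle_mass m k"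
    and "spaced r t k" "0 < r" "r \<le> b"
  shows "(measure_pmf.prob p (windows r (\<lambda>s. t s - b) k) +
      measure_pmf.prob p (windows r (\<lambda>s. t s + b) k)) / 2 \<le> middle_mass (Suc m) k"
proof (cases k)
  case (Suc k')
  have spaced: "spaced r t (Suc k')" using assms(2) Suc by simp
  have "measure_pmf.prob p (windows r (\<lambda>s. t s - b) (Suc k')) +
      measure_pmf.prob p (windows r (\<lambda>s. t s + b) (Suc k'))
    \<le> measure_pmf.prob p (windows r ((\<lambda>s. t s - b)(Suc k' := t k' + b)) (Suc (Suc k'))) +
      measure_pmf.prob p (windows r (\<lambda>s. t s + b) k')"
    by (rule prob_windows_exchange[OF spaced assms(3,4)])
  also have "\<dots> \<le> middle_mass m (Suc (Suc k')) + middle_mass m k'"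
  proof (intro add_mono assms(1) spaced_exchange spaced assms(4))
    show "spaced r (\<lambda>s. t s + b) k'"
      using spaced_shift(2)[OF spaced] by (simp add: spaced_def)
  qed
  finally show ?thesis unfolding Suc middle_mass_Suc by simp
qed (simp add: windows_def)

lemma prob_rademacher_sum_windows_le:
  assumes "finite A" "0 < r" "spaced r t k"
  shows "measure_pmf.prob (rademacher_sum A a) (windows r t k)
    \<le> middle_mass (card {l \<in> A. r \<le> \<bar>a l\<bar>}) k"
  using assms(1,3)
proof (induction A arbitrary: k t rule: finite_induct)
  case empty
  show ?case
  proof (cases k)
    case (Suc k')
    then show ?thesis
      using order_trans[OF measure_pmf.prob_le_1 middle_mass_0_left[of k']] by simp
  qed (simp add: windows_def)
next
  case (insert x A)
  show ?case
  proof (cases "r \<le> \<bar>a x\<bar>")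
    case True
    then have "{l \<in> insert x A. r \<le> \<bar>a l\<bar>} = insert x {l \<in> A. r \<le> \<bar>a l\<bar>}" by auto
    then have "card {l \<in> insert x A. r \<le> \<bar>a l\<bar>} = Suc (card {l \<in> A. r \<le> \<bar>a l\<bar>})"
      using insert.hyps by simp
    then show ?thesis
      unfolding prob_rademacher_sum_insert_windows[OF insert.hyps]
      using prob_shifted_windows_le[OF insert.IH insert.prems \<open>0 < r\<close> True] by simp
  next
    case False
    then have "{l \<in> insert x A. r \<le> \<bar>a l\<bar>} = {l \<in> A. r \<le> \<bar>a l\<bar>}" by auto
    then show ?thesis
      using insert.IH[OF spaced_shift(1)[OF insert.prems, of "\<bar>a x\<bar>"]]
        insert.IH[OF spaced_shift(2)[OF insert.prems, of "\<bar>a x\<bar>"]]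
      by (simp add: prob_rademacher_sum_insert_windows[OF insert.hyps])
  qed
qed

lemma littlewood_offord:
  assumes "finite A" "0 < r"
  shows "measure_pmf.prob (rademacher_sum A a) {y. \<bar>b + y\<bar> < r}
    \<le> 1 / sqrt (real (card {l \<in> A. r \<le> \<bar>a l\<bar>}) + 1)"
proof -
  have "measure_pmf.prob (rademacher_sum A a) {y. \<bar>b + y\<bar> < r}
      \<le> measure_pmf.prob (rademacher_sum A a) (windows r (\<lambda>_. - b - r) 1)"
    by (rule measure_pmf.finite_measure_mono) (auto simp: windows_def)
  also have "\<dots> \<le> middle_mass (card {l \<in> A. r \<le> \<bar>a l\<bar>}) 1"
    by (rule prob_rademacher_sum_windows_le[OF assms]) (simp add: spaced_def)
  also have "\<dots> \<le> 1 / sqrt (real (card {l \<in> A. r \<le> \<bar>a l\<bar>}) + 1)"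
    by (rule middle_mass_1_le)
  finally show ?thesis .
qed

subsection \<open>Uniformly random subsets\<close>

definition card_subsets :: "nat \<Rightarrow> nat \<Rightarrow> nat set set" where
  "card_subsets n K = {S. S \<subseteq> {..<n} \<and> card S = K}"

lemma finite_card_subsets [simp]: "finite (card_subsets n K)"
  by (simp add: card_subsets_def)

lemma card_card_subsets: "card (card_subsets n K) = n choose K"
  using n_subsets[of "{..<n}" K] by (simp add: card_subsets_def)

lemma card_subsets_nonempty:
  assumes "K \<le> n"
  shows "card_subsets n K \<noteq> {}"
  using assms card_card_subsets[of n K] by (metis binomial_eq_0_iff card.empty not_less)

lemma set_pmf_of_card_subsets:
  assumes "K \<le> n"
  shows "set_pmf (pmf_of_set (card_subsets n K)) = card_subsets n K"
  using card_subsets_nonempty[OF assms] by simp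

lemma card_card_subsets_containing:
  assumes "B \<subseteq> {..<n}" "card B \<le> K"
  shows "card {S \<in> card_subsets n K. B \<subseteq> S} = (n - card B) choose (K - card B)"
proof -
  have finB: "finite B" using assms(1) finite_subset by blast
  have "bij_betw (\<lambda>S. S - B) {S \<in> card_subsets n K. B \<subseteq> S}
      {T. T \<subseteq> {..<n} - B \<and> card T = K - card B}"
  proof (rule bij_betw_byWitness[where f' = "\<lambda>T. T \<union> B"])
    show "(\<lambda>S. S - B) ` {S \<in> card_subsets n K. B \<subseteq> S}
        \<subseteq> {T. T \<subseteq> {..<n} - B \<and> card T = K - card B}"
      using finB by (auto simp: card_subsets_def card_Diff_subset)
    have "card (T \<union> B) = K" if "T \<subseteq> {..<n} - B" "card T = K - card B" for T
    proof -
      have "finite T" using that(1) finite_subset by blast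
      then have "card (T \<union> B) = card T + card B"
        using that finB by (intro card_Un_disjoint) auto
      then show ?thesis using that assms by simp
    qed
    then show "(\<lambda>T. T \<union> B) ` {T. T \<subseteq> {..<n} - B \<and> card T = K - card B}
        \<subseteq> {S \<in> card_subsets n K. B \<subseteq> S}"
      using assms(1) by (auto simp: card_subsets_def)
  qed auto
  then have "card {S \<in> card_subsets n K. B \<subseteq> S}
      = card {T. T \<subseteq> {..<n} - B \<and> card T = K - card B}"
    by (rule bij_betw_same_card)
  also have "\<dots> = (n - card B) choose (K - card B)"
    using n_subsets[of "{..<n} - B" "K - card B"] assms(1) finB by (simp add: card_Diff_subset)
  finally show ?thesis .
qed

lemma prob_random_subset_contains:
  assumes "K \<le> n" "B \<subseteq> {..<n}" "card B \<le> K"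
  shows "measure_pmf.prob (pmf_of_set (card_subsets n K)) {S. B \<subseteq> S}
    = real ((n - card B) choose (K - card B)) / real (n choose K)"
  using card_card_subsets_containing[OF assms(2,3)] card_subsets_nonempty[OF assms(1)]
  by (simp add: measure_pmf_of_set card_card_subsets Int_def)

lemma binomial_minus_one_quotient:
  assumes "1 \<le> K" "K \<le> n"
  shows "real ((n - 1) choose (K - 1)) / real (n choose K) = real K / real n"
proof -
  have "K * (n choose K) = n * ((n - 1) choose (K - 1))"
    using times_binomial_minus1_eq[of K n] assms by simp
  then have "real K * real (n choose K) = real n * real ((n - 1) choose (K - 1))"
    by (metis of_nat_mult)
  then show ?thesis using assms by (simp add: field_simps)
qed

lemma prob_random_subset_contains_1:
  assumes "1 \<le> K" "K \<le> n" "j < n"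
  shows "measure_pmf.prob (pmf_of_set (card_subsets n K)) {S. j \<in> S} = real K / real n"
  using prob_random_subset_contains[of K n "{j}"] binomial_minus_one_quotient[of K n] assms by simp

lemma prob_random_subset_contains_2:
  assumes "1 \<le> K" "K \<le> n" "j < n" "j' < n" "j \<noteq> j'"
  shows "measure_pmf.prob (pmf_of_set (card_subsets n K)) {S. j \<in> S \<and> j' \<in> S}
    \<le> (real K / real n)\<^sup>2"
proof (cases "K = 1")
  case True
  have "card_subsets n K \<inter> {S. j \<in> S \<and> j' \<in> S} = {}"
    using True assms(5) by (auto simp: card_subsets_def card_1_singleton_iff)
  then show ?thesis
    using card_subsets_nonempty[OF assms(2)] by (simp add: measure_pmf_of_set)
next
  case False
  then have K: "2 \<le> K" using assms by simp
  have "measure_pmf.prob (pmf_of_set (card_subsets n K)) {S. j \<in> S \<and> j' \<in> S}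
      = real ((n - 2) choose (K - 2)) / real (n choose K)"
    using prob_random_subset_contains[of K n "{j, j'}"] assms K by (simp add: numeral_2_eq_2)
  also have "\<dots> = real ((n - 2) choose (K - 2)) / real ((n - 1) choose (K - 1)) *
      (real ((n - 1) choose (K - 1)) / real (n choose K))"
    using assms by simp
  also have "\<dots> = real (K - 1) / real (n - 1) * (real K / real n)"
    using binomial_minus_one_quotient[of "K - 1" "n - 1"] binomial_minus_one_quotient[of K n]
      assms K
    by (simp add: numeral_2_eq_2)
  also have "\<dots> \<le> real K / real n * (real K / real n)"
    using K assms by (intro mult_right_mono) (simp_all add: field_simps of_nat_diff)
  finally show ?thesis by (simp add: power2_eq_square)
qed

lemma integrable_pmf_of_card_subsets:
  fixes f :: "nat set \<Rightarrow> real"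
  assumes "K \<le> n"
  shows "integrable (measure_pmf (pmf_of_set (card_subsets n K))) f"
  by (rule integrable_measure_pmf_finite) (simp add: set_pmf_of_card_subsets[OF assms])

lemma expectation_card_Int_random_subset:
  assumes "1 \<le> K" "K \<le> n" "T \<subseteq> {..<n}"
  shows "measure_pmf.expectation (pmf_of_set (card_subsets n K)) (\<lambda>S. real (card (S \<inter> T)))
    = real K * real (card T) / real n"
proof -
  have finT: "finite T" using assms(3) finite_subset by blast
  have "measure_pmf.expectation (pmf_of_set (card_subsets n K)) (\<lambda>S. real (card (S \<inter> T)))
      = measure_pmf.expectation (pmf_of_set (card_subsets n K))
          (\<lambda>S. \<Sum>j\<in>T. indicat_real {S. j \<in> S} S)"
    using finT by (simp add: indicator_def Int_commute)
  also have "\<dots> = (\<Sum>j\<in>T. measure_pmf.prob (pmf_of_set (card_subsets n K)) {S. j \<in> S})"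
    by (subst Bochner_Integration.integral_sum) (auto intro: integrable_pmf_of_card_subsets assms)
  also have "\<dots> = (\<Sum>j\<in>T. real K / real n)"
    using assms by (intro sum.cong prob_random_subset_contains_1) auto
  finally show ?thesis by simp
qed

lemma second_moment_card_Int_random_subset:
  assumes "1 \<le> K" "K \<le> n" "T \<subseteq> {..<n}"
  defines "\<mu> \<equiv> real K * real (card T) / real n"
  shows "measure_pmf.expectation (pmf_of_set (card_subsets n K)) (\<lambda>S. (real (card (S \<inter> T)))\<^sup>2)
    \<le> \<mu>\<^sup>2 + \<mu>"
proof -
  let ?P = "pmf_of_set (card_subsets n K)"
  define p where "p = real K / real n"
  have finT: "finite T" using assms(3) finite_subset by blast
  have "(real (card (S \<inter> T)))\<^sup>2 = (\<Sum>j\<in>T. \<Sum>j'\<in>T. indicat_real {S. j \<in> S \<and> j' \<in> S} S)" for S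
  proof -
    have "real (card (S \<inter> T)) = (\<Sum>j\<in>T. of_bool (j \<in> S))"
      using finT by (simp add: Int_commute)
    then show ?thesis
      by (simp add: power2_eq_square sum_product indicator_def of_bool_conj)
  qed
  then have "measure_pmf.expectation ?P (\<lambda>S. (real (card (S \<inter> T)))\<^sup>2)
      = (\<Sum>j\<in>T. \<Sum>j'\<in>T. measure_pmf.prob ?P {S. j \<in> S \<and> j' \<in> S})"
    by (simp add: Bochner_Integration.integral_sum integrable_pmf_of_card_subsets[OF assms(2)])
  also have "\<dots> \<le> (\<Sum>j\<in>T. \<Sum>j'\<in>T. p\<^sup>2 + (if j' = j then p else 0))"
  proof (intro sum_mono)
    fix j j' assume "j \<in> T" "j' \<in> T"
    then show "measure_pmf.prob ?P {S. j \<in> S \<and> j' \<in> S} \<le> p\<^sup>2 + (if j' = j then p else 0)"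
      using prob_random_subset_contains_1[of K n j] prob_random_subset_contains_2[of K n j j'] assms
      by (cases "j' = j") (auto simp: p_def)
  qed
  also have "\<dots> = (\<Sum>j\<in>T. real (card T) * p\<^sup>2 + p)"
    using finT by (intro sum.cong refl) (simp add: sum.distrib)
  also have "\<dots> = \<mu>\<^sup>2 + \<mu>"
    by (simp add: \<mu>_def p_def power2_eq_square algebra_simps)
  finally show ?thesis .
qed

lemma prob_card_Int_random_subset_small:
  assumes "1 \<le> K" "K \<le> n" "T \<subseteq> {..<n}" and \<mu>: "0 < \<mu>" "\<mu> \<le> real K * real (card T) / real n"
  shows "measure_pmf.prob (pmf_of_set (card_subsets n K)) {S. real (card (S \<inter> T)) < \<mu> / 2} \<le> 4 / \<mu>"
proof -
  let ?P = "pmf_of_set (card_subsets n K)"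
  define mean where "mean = real K * real (card T) / real n"
  have mean: "0 < mean" "\<mu> \<le> mean" using \<mu> by (simp_all add: mean_def)
  have expectation: "measure_pmf.expectation ?P (\<lambda>S. real (card (S \<inter> T))) = mean"
    unfolding mean_def by (rule expectation_card_Int_random_subset[OF assms(1-3)])
  have variance: "measure_pmf.variance ?P (\<lambda>S. real (card (S \<inter> T))) \<le> mean"
    using second_moment_card_Int_random_subset[OF assms(1-3)]
    by (subst measure_pmf.variance_eq)
      (simp_all add: integrable_pmf_of_card_subsets[OF assms(2)] expectation mean_def)
  have "measure_pmf.prob ?P {S. real (card (S \<inter> T)) < \<mu> / 2}
      \<le> measure_pmf.prob ?P {S. mean / 2 \<le> \<bar>real (card (S \<inter> T)) - mean\<bar>}"
    using mean by (intro measure_pmf.finite_measure_mono) auto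
  also have "\<dots> \<le> measure_pmf.variance ?P (\<lambda>S. real (card (S \<inter> T))) / (mean / 2)\<^sup>2"
    using measure_pmf.Chebyshev_inequality[of "\<lambda>S. real (card (S \<inter> T))" ?P "mean / 2"] mean
    by (simp add: integrable_pmf_of_card_subsets[OF assms(2)] expectation)
  also have "\<dots> \<le> mean / (mean / 2)\<^sup>2" by (rule divide_right_mono[OF variance]) simp
  also have "\<dots> = 4 / mean" using mean by (simp add: power2_eq_square)
  also have "\<dots> \<le> 4 / \<mu>" using mean \<mu> by (intro divide_left_mono) auto
  finally show ?thesis .
qed

lemma bij_betw_nth_sorted_list_of_set:
  "finite S \<Longrightarrow> bij_betw ((!) (sorted_list_of_set S)) {..<card S} S"
  by (intro bij_betw_nth) auto

lemma littlewood_offord_fixed_support: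
  fixes w :: "nat \<Rightarrow> real" and e :: "'b \<Rightarrow> nat"
  assumes "finite S" "bij_betw e B {..<card S}" "0 < r"
  shows "measure_pmf.prob (rademacher_signs B)
      {X. \<bar>b + (\<Sum>p\<in>B. w (sorted_list_of_set S ! e p) * X p)\<bar> < r}
    \<le> 1 / sqrt (real (card {j \<in> S. r \<le> \<bar>w j\<bar>}) + 1)"
proof -
  define s where "s p = sorted_list_of_set S ! e p" for p
  have finB: "finite B" using assms(2) bij_betw_finite by blast
  have s: "bij_betw s B S"
    using bij_betw_trans[OF assms(2) bij_betw_nth_sorted_list_of_set[OF assms(1)]]
    by (simp add: s_def[abs_def] comp_def)
  then have "s ` {p \<in> B. r \<le> \<bar>w (s p)\<bar>} = {j \<in> S. r \<le> \<bar>w j\<bar>}"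
    by (auto simp: bij_betw_def)
  moreover have "inj_on s {p \<in> B. r \<le> \<bar>w (s p)\<bar>}"
    using s by (auto simp: bij_betw_def inj_on_def)
  ultimately have "card {p \<in> B. r \<le> \<bar>w (s p)\<bar>} = card {j \<in> S. r \<le> \<bar>w j\<bar>}"
    using card_image by fastforce
  then show ?thesis
    using littlewood_offord[OF finB assms(3), of "\<lambda>p. w (s p)" b]
    by (simp add: rademacher_sum_def vimage_def s_def)
qed

lemma littlewood_offord_random_support:
  fixes w :: "nat \<Rightarrow> real" and e :: "'b \<Rightarrow> nat"
  assumes "1 \<le> K" "K \<le> n" and e: "bij_betw e B {..<K}" and "0 < r"
    and \<mu>: "0 < \<mu>" "\<mu> \<le> real K * real (card {j. j < n \<and> r \<le> \<bar>w j\<bar>}) / real n"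
  shows "measure_pmf.prob (pair_pmf (pmf_of_set (card_subsets n K)) (rademacher_signs B))
      {(S, X). \<bar>b + (\<Sum>p\<in>B. w (sorted_list_of_set S ! e p) * X p)\<bar> < r} \<le> 4 / \<mu> + sqrt (2 / \<mu>)"
    (is "measure_pmf.prob (pair_pmf ?P ?R) ?E \<le> _")
proof -
  define T where "T = {j. j < n \<and> r \<le> \<bar>w j\<bar>}"
  define Few where "Few = {(S, X :: 'b \<Rightarrow> real). real (card (S \<inter> T)) < \<mu> / 2}"
  have few: "measure_pmf.prob (pair_pmf ?P ?R) Few \<le> 4 / \<mu>"
  proof (rule prob_pair_pmf_le_snd)
    show "measure_pmf.prob ?P {S. (S, X) \<in> Few} \<le> 4 / \<mu>" for X
      using prob_card_Int_random_subset_small[of K n T \<mu>] assms by (auto simp: Few_def T_def)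
  qed (use \<mu> in simp)
  have many: "measure_pmf.prob (pair_pmf ?P ?R) (?E - Few) \<le> sqrt (2 / \<mu>)"
  proof (rule prob_pair_pmf_le_fst)
    fix S assume "S \<in> set_pmf ?P"
    then have S: "S \<subseteq> {..<n}" "card S = K"
      unfolding set_pmf_of_card_subsets[OF \<open>K \<le> n\<close>] by (auto simp: card_subsets_def)
    then have finS: "finite S" using finite_subset by blast
    have T: "{j \<in> S. r \<le> \<bar>w j\<bar>} = S \<inter> T" using S(1) by (auto simp: T_def)
    show "measure_pmf.prob ?R {X. (S, X) \<in> ?E - Few} \<le> sqrt (2 / \<mu>)"
    proof (cases "\<mu> / 2 \<le> real (card (S \<inter> T))")
      case True
      then have "{X. (S, X) \<in> ?E - Few}
          = {X. \<bar>b + (\<Sum>p\<in>B. w (sorted_list_of_set S ! e p) * X p)\<bar> < r}"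
        by (auto simp: Few_def)
      then have "measure_pmf.prob ?R {X. (S, X) \<in> ?E - Few} \<le> 1 / sqrt (real (card (S \<inter> T)) + 1)"
        using littlewood_offord_fixed_support[OF finS _ \<open>0 < r\<close>, of e B b w] e by (simp add: S T)
      also have "\<dots> \<le> 1 / sqrt (\<mu> / 2)"
        using True \<mu> by (intro divide_left_mono) auto
      finally show ?thesis by (simp add: real_sqrt_divide)
    qed (use \<mu> in \<open>simp add: Few_def\<close>)
  qed (use \<mu> in simp)
  have "measure_pmf.prob (pair_pmf ?P ?R) ?E
      \<le> measure_pmf.prob (pair_pmf ?P ?R) (Few \<union> (?E - Few))"
    by (intro measure_pmf.finite_measure_mono) auto
  also have "\<dots> \<le> measure_pmf.prob (pair_pmf ?P ?R) Few +
      measure_pmf.prob (pair_pmf ?P ?R) (?E - Few)"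
    by (rule measure_Un_le) auto
  finally show ?thesis using few many by linarith
qed

definition row_count :: "nat \<Rightarrow> (nat \<Rightarrow> nat set) \<Rightarrow> nat \<Rightarrow> nat" where
  "row_count n J j = card {i. i < n \<and> j \<in> J i}"

definition heavy_rows :: "nat \<Rightarrow> nat \<Rightarrow> (nat \<Rightarrow> nat set) \<Rightarrow> nat set" where
  "heavy_rows n L J = {j. j < n \<and> L \<le> row_count n J j}"

definition random_subsets :: "nat \<Rightarrow> nat \<Rightarrow> (nat \<Rightarrow> nat set) pmf" where
  "random_subsets n K = Pi_pmf {..<n} {} (\<lambda>_. pmf_of_set (card_subsets n K))"

lemma set_pmf_random_subsets:
  assumes "K \<le> n" "J \<in> set_pmf (random_subsets n K)" "i < n"
  shows "J i \<subseteq> {..<n}" "card (J i) = K"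
  using assms(2,3) set_pmf_of_card_subsets[OF assms(1)]
  by (auto simp: random_subsets_def set_Pi_pmf PiE_dflt_def card_subsets_def)

lemma integrable_random_subsets:
  fixes f :: "(nat \<Rightarrow> nat set) \<Rightarrow> real"
  assumes "K \<le> n"
  shows "integrable (measure_pmf (random_subsets n K)) f"
  by (rule integrable_measure_pmf_finite)
    (simp add: random_subsets_def set_Pi_pmf finite_PiE_dflt set_pmf_of_card_subsets[OF assms])

lemma expectation_power_row_count:
  assumes "1 \<le> K" "K \<le> n" "j < n" "1 \<le> (c :: real)"
  shows "measure_pmf.expectation (random_subsets n K) (\<lambda>J. c ^ row_count n J j)
    \<le> exp ((c - 1) * real K)"
proof -
  let ?P = "pmf_of_set (card_subsets n K)"
  have "c ^ row_count n J j = (\<Prod>i<n. if j \<in> J i then c else 1)" for J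
  proof -
    have "{i. i < n \<and> j \<in> J i} = {i \<in> {..<n}. j \<in> J i}" by auto
    then show ?thesis by (simp add: row_count_def prod.If_cases Int_def)
  qed
  then have "measure_pmf.expectation (random_subsets n K) (\<lambda>J. c ^ row_count n J j)
      = measure_pmf.expectation (random_subsets n K) (\<lambda>J. \<Prod>i<n. if j \<in> J i then c else 1)"
    by simp
  also have "\<dots> = (\<Prod>i<n. measure_pmf.expectation ?P (\<lambda>S. if j \<in> S then c else 1))"
    unfolding random_subsets_def
    by (rule expectation_prod_Pi_pmf) (use assms in \<open>auto intro: integrable_pmf_of_card_subsets\<close>)
  also have "measure_pmf.expectation ?P (\<lambda>S. if j \<in> S then c else 1)
      = measure_pmf.expectation ?P (\<lambda>S. 1 + (c - 1) * indicat_real {S. j \<in> S} S)"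
    by (intro Bochner_Integration.integral_cong) (auto simp: indicator_def)
  also have "\<dots> = 1 + (c - 1) * (real K / real n)"
    by (simp add: integrable_pmf_of_card_subsets[OF assms(2)]
        prob_random_subset_contains_1[OF assms(1-3)])
  also have "(\<Prod>i<n. 1 + (c - 1) * (real K / real n)) \<le> (\<Prod>i<n. exp ((c - 1) * (real K / real n)))"
    using assms by (intro prod_mono) (auto simp: add_nonneg_nonneg)
  also have "\<dots> = exp ((c - 1) * real K)"
    using assms by (simp add: exp_of_nat_mult[symmetric])
  finally show ?thesis .
qed

lemma le_four_power_divide:
  assumes "L \<le> c"
  shows "real c \<le> 4 ^ c / 2 ^ L"
proof -
  have "real c * 2 ^ L \<le> 2 ^ c * 2 ^ c"
    using assms of_nat_less_two_power[of c] by (intro mult_mono power_increasing) auto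
  also have "\<dots> = (4 :: real) ^ c" by (simp add: power_mult_distrib[symmetric])
  finally show ?thesis by (simp add: field_simps)
qed

lemma prob_heavy_rows_weight_le:
  assumes "1 \<le> K" "K \<le> n" "0 < t"
  shows "measure_pmf.prob (random_subsets n K)
      {J. t \<le> (\<Sum>j\<in>heavy_rows n L J. real (row_count n J j))}
    \<le> real n * (exp (3 * real K) / 2 ^ L) / t"
proof -
  have weight: "(\<Sum>j\<in>heavy_rows n L J. real (row_count n J j)) \<le> (\<Sum>j<n. 4 ^ row_count n J j / 2 ^ L)"
    for J
  proof -
    have "(\<Sum>j\<in>heavy_rows n L J. real (row_count n J j))
        \<le> (\<Sum>j\<in>heavy_rows n L J. 4 ^ row_count n J j / 2 ^ L)"
      by (intro sum_mono le_four_power_divide) (simp add: heavy_rows_def)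
    also have "\<dots> \<le> (\<Sum>j<n. 4 ^ row_count n J j / 2 ^ L)"
      by (intro sum_mono2) (auto simp: heavy_rows_def)
    finally show ?thesis .
  qed
  have "measure_pmf.prob (random_subsets n K) {J. t \<le> (\<Sum>j\<in>heavy_rows n L J. real (row_count n J j))}
      \<le> measure_pmf.prob (random_subsets n K) {J. t \<le> (\<Sum>j<n. 4 ^ row_count n J j / 2 ^ L)}"
    by (rule measure_pmf.finite_measure_mono) (auto intro: order_trans[OF _ weight])
  also have "\<dots> \<le> measure_pmf.expectation (random_subsets n K)
      (\<lambda>J. \<Sum>j<n. 4 ^ row_count n J j / 2 ^ L) / t"
    by (rule measure_pmf_Markov)
      (use assms in \<open>auto intro!: integrable_random_subsets sum_nonneg\<close>)
  also have "measure_pmf.expectation (random_subsets n K) (\<lambda>J. \<Sum>j<n. 4 ^ row_count n J j / 2 ^ L)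
      = (\<Sum>j<n. measure_pmf.expectation (random_subsets n K) (\<lambda>J. 4 ^ row_count n J j) / 2 ^ L ::
          real)"
    by (simp add: Bochner_Integration.integral_sum integrable_random_subsets[OF assms(2)])
  also have "\<dots> \<le> (\<Sum>j<n. exp (3 * real K) / 2 ^ L)"
    using expectation_power_row_count[OF assms(1,2), of _ 4]
    by (intro sum_mono divide_right_mono) auto
  finally show ?thesis using assms(3) by (simp add: divide_right_mono)
qed

subsection \<open>Sign patterns of affine functionals\<close>

lemma ex_nontrivial_solution:
  fixes a :: "'e \<Rightarrow> 'b \<Rightarrow> real"
  assumes "finite E" "finite B" "card E < card B"
  shows "\<exists>x. (\<exists>b\<in>B. x b \<noteq> 0) \<and> (\<forall>e\<in>E. (\<Sum>b\<in>B. a e b * x b) = 0)"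
proof -
  obtain h where h: "bij_betw h {..<card B} B"
    using ex_bij_betw_nat_finite[OF assms(2)] by (auto simp: atLeast0LessThan)
  obtain k where k: "bij_betw k {..<card E} E"
    using ex_bij_betw_nat_finite[OF assms(1)] by (auto simp: atLeast0LessThan)
  define N where "N = Matrix.mat (card B) (card B)
    (\<lambda>(r, c). if r < card E then a (k r) (h c) else 0)"
  have N: "N \<in> carrier_mat (card B) (card B)" by (simp add: N_def)
  have "N = mat\<^sub>r (card B) (card B) (\<lambda>r. if r = card E then 0\<^sub>v (card B)
      else Matrix.vec (card B) (\<lambda>c. if r < card E then a (k r) (h c) else 0))"
    by (rule eq_matI) (auto simp: N_def)
  then have "det N = 0" by (simp only:) (rule det_row_0[OF assms(3)], simp)
  then obtain v where v: "v \<in> carrier_vec (card B)" "v \<noteq> 0\<^sub>v (card B)" "N *\<^sub>v v = 0\<^sub>v (card B)"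
    using det_0_iff_vec_prod_zero[OF N] by blast
  define x where "x b = v $ inv_into {..<card B} h b" for b
  have x: "x (h c) = v $ c" if "c < card B" for c
    using h that by (simp add: x_def bij_betw_def inv_into_f_f)
  have "(\<Sum>b\<in>B. a (k r) b * x b) = 0" if r: "r < card E" for r
  proof -
    have "(\<Sum>b\<in>B. a (k r) b * x b) = (\<Sum>c<card B. a (k r) (h c) * v $ c)"
      by (simp add: sum.reindex_bij_betw[OF h, symmetric] x)
    also have "\<dots> = (N *\<^sub>v v) $ r"
      using r assms(3) v(1) by (simp add: N_def scalar_prod_def atLeast0LessThan)
    finally show ?thesis using r assms(3) by (simp add: v(3))
  qed
  then have "\<forall>e\<in>k ` {..<card E}. (\<Sum>b\<in>B. a e b * x b) = 0" by simp
  then have "\<forall>e\<in>E. (\<Sum>b\<in>B. a e b * x b) = 0" unfolding bij_betw_imp_surj_on[OF k] .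
  moreover have "\<exists>b\<in>B. x b \<noteq> 0"
  proof -
    obtain c where "c < card B" "v $ c \<noteq> 0"
      using v(1,2) by (metis carrier_vecD eq_vecI index_zero_vec)
    then show ?thesis using x[of c] bij_betw_apply[OF h, of c] by (intro bexI[of _ "h c"]) auto
  qed
  ultimately show ?thesis by blast
qed

definition shatters :: "'a set set \<Rightarrow> 'a set \<Rightarrow> bool" where
  "shatters \<F> B \<longleftrightarrow> (\<forall>C\<subseteq>B. \<exists>Z\<in>\<F>. Z \<inter> B = C)"

definition deletion :: "'a \<Rightarrow> 'a set set \<Rightarrow> 'a set set" where
  "deletion x \<F> = {Z \<in> \<F>. x \<notin> Z}"

definition link :: "'a \<Rightarrow> 'a set set \<Rightarrow> 'a set set" where
  "link x \<F> = {Z. x \<notin> Z \<and> insert x Z \<in> \<F>}"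

lemma card_deletion_add_link:
  assumes "finite \<F>"
  shows "card \<F> = card (deletion x \<F>) + card (link x \<F>)"
proof -
  have "{Z \<in> \<F>. x \<in> Z} = insert x ` link x \<F>"
    by (auto simp: link_def insert_absorb intro!: image_eqI[where x = "_ - {x}"])
  moreover have "inj_on (insert x) (link x \<F>)" by (auto simp: inj_on_def link_def)
  ultimately have "card {Z \<in> \<F>. x \<in> Z} = card (link x \<F>)" by (simp add: card_image)
  moreover have "card \<F> = card {Z \<in> \<F>. x \<notin> Z} + card {Z \<in> \<F>. x \<in> Z}"
    using assms by (subst card_Un_disjoint[symmetric]) (auto intro!: arg_cong[of _ _ card])
  ultimately show ?thesis by (simp add: deletion_def)
qed

lemma shatters_if_deletion_Un_link:
  assumes "shatters (deletion x \<F> \<union> link x \<F>) B" "x \<notin> B"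
  shows "shatters \<F> B"
  unfolding shatters_def
proof (intro allI impI)
  fix C assume "C \<subseteq> B"
  then obtain Z where Z: "Z \<in> deletion x \<F> \<union> link x \<F>" "Z \<inter> B = C"
    using assms(1) unfolding shatters_def by metis
  moreover have "insert x Z \<inter> B = C" using Z(2) assms(2) by auto
  ultimately show "\<exists>Z\<in>\<F>. Z \<inter> B = C" by (auto simp: deletion_def link_def)
qed

lemma shatters_insert_if_deletion_Int_link:
  assumes "shatters (deletion x \<F> \<inter> link x \<F>) B" "x \<notin> B"
  shows "shatters \<F> (insert x B)"
  unfolding shatters_def
proof (intro allI impI)
  fix C assume "C \<subseteq> insert x B"
  then have "C - {x} \<subseteq> B" by auto
  then obtain Z where Z: "Z \<in> deletion x \<F> \<inter> link x \<F>" "Z \<inter> B = C - {x}"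
    using assms(1) unfolding shatters_def by metis
  show "\<exists>Z\<in>\<F>. Z \<inter> insert x B = C"
  proof (cases "x \<in> C")
    case True
    then show ?thesis using Z assms(2) by (intro bexI[of _ "insert x Z"]) (auto simp: link_def)
  next
    case False
    then show ?thesis using Z by (intro bexI[of _ Z]) (auto simp: deletion_def)
  qed
qed

lemma card_le_card_shattered:
  assumes "finite I" "\<F> \<subseteq> Pow I"
  shows "card \<F> \<le> card {B. B \<subseteq> I \<and> shatters \<F> B}"
  using assms
proof (induction I arbitrary: \<F> rule: finite_induct)
  case empty
  then consider "\<F> = {}" | "\<F> = {{}}" by auto
  then show ?case
  proof cases
    case 2
    then have "{B. B \<subseteq> {} \<and> shatters \<F> B} = {{}}" by (auto simp: shatters_def)
    then show ?thesis using 2 by simp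
  qed simp
next
  case (insert x I)
  let ?D = "deletion x \<F>" and ?L = "link x \<F>"
  let ?sh = "\<lambda>\<G>. {B. B \<subseteq> I \<and> shatters \<G> B}"
  have sub: "?D \<subseteq> Pow I" "?L \<subseteq> Pow I"
    using insert.prems by (auto simp: deletion_def link_def)
  then have fin: "finite ?D" "finite ?L" using insert.hyps by (auto intro: finite_subset)
  have "card \<F> = card ?D + card ?L"
    using insert.hyps insert.prems by (intro card_deletion_add_link) (auto intro: finite_subset)
  also have "\<dots> = card (?D \<union> ?L) + card (?D \<inter> ?L)" using fin by (rule card_Un_Int)
  also have "\<dots> \<le> card (?sh (?D \<union> ?L)) + card (?sh (?D \<inter> ?L))"
    by (intro add_mono insert.IH) (use sub in auto)
  also have "\<dots> = card (?sh (?D \<union> ?L) \<union> insert x ` ?sh (?D \<inter> ?L))"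
  proof -
    have "inj_on (insert x) (?sh (?D \<inter> ?L))" using insert.hyps by (auto simp: inj_on_def)
    moreover have "?sh (?D \<union> ?L) \<inter> insert x ` ?sh (?D \<inter> ?L) = {}" using insert.hyps by auto
    ultimately show ?thesis using insert.hyps by (simp add: card_Un_disjoint card_image)
  qed
  also have "\<dots> \<le> card {B. B \<subseteq> insert x I \<and> shatters \<F> B}"
    using insert.hyps
    by (intro card_mono)
      (auto dest!: shatters_if_deletion_Un_link shatters_insert_if_deletion_Int_link)
  finally show ?case .
qed

lemma card_small_subsets:
  fixes x :: real
  assumes "finite I" "0 < x" "x \<le> 1"
  shows "real (card {B. B \<subseteq> I \<and> card B \<le> m}) \<le> (1 + x) ^ card I / x ^ m"
proof -
  have "real (card {B. B \<subseteq> I \<and> card B \<le> m}) * x ^ m = (\<Sum>B | B \<subseteq> I \<and> card B \<le> m. x ^ m)"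
    by simp
  also have "\<dots> \<le> (\<Sum>B | B \<subseteq> I \<and> card B \<le> m. x ^ card B)"
    using assms by (intro sum_mono power_decreasing) auto
  also have "\<dots> \<le> (\<Sum>B\<in>Pow I. x ^ card B)"
    using assms by (intro sum_mono2) auto
  also have "\<dots> = (1 + x) ^ card I"
    using prod_add[OF assms(1), of "\<lambda>_. x" "\<lambda>_. 1"] by (simp add: add.commute)
  finally show ?thesis using assms by (simp add: field_simps)
qed

definition affine_eval :: "'d set \<Rightarrow> real \<times> ('d \<Rightarrow> real) \<Rightarrow> ('d \<Rightarrow> real) \<Rightarrow> real" where
  "affine_eval D \<phi> u = fst \<phi> + (\<Sum>d\<in>D. snd \<phi> d * u d)"

definition nonneg_pattern ::
  "'d set \<Rightarrow> (real \<times> ('d \<Rightarrow> real)) set \<Rightarrow> ('d \<Rightarrow> real) \<Rightarrow> (real \<times> ('d \<Rightarrow> real)) set" where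
  "nonneg_pattern D \<Phi> u = {\<phi> \<in> \<Phi>. 0 \<le> affine_eval D \<phi> u}"

lemma ex_affine_dependence:
  assumes "finite D" "finite B" "card D + 1 < card B"
  shows "\<exists>z. (\<exists>\<phi>\<in>B. z \<phi> < 0) \<and> (\<forall>u. (\<Sum>\<phi>\<in>B. z \<phi> * affine_eval D \<phi> u) = 0)"
proof -
  define coeff where "coeff e \<phi> = (case e of None \<Rightarrow> fst \<phi> | Some d \<Rightarrow> snd \<phi> d)"
    for e and \<phi> :: "real \<times> ('a \<Rightarrow> real)"
  have "card (insert None (Some ` D)) < card B"
    using assms(1,3) by (simp add: card_image card_insert_if)
  then obtain y where y: "\<exists>\<phi>\<in>B. y \<phi> \<noteq> 0"
    and zero: "\<forall>e\<in>insert None (Some ` D). (\<Sum>\<phi>\<in>B. coeff e \<phi> * y \<phi>) = 0"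
    using ex_nontrivial_solution[of "insert None (Some ` D)" B coeff] assms by auto
  have dependence: "(\<Sum>\<phi>\<in>B. y \<phi> * affine_eval D \<phi> u) = 0" for u
  proof -
    have "(\<Sum>\<phi>\<in>B. y \<phi> * affine_eval D \<phi> u)
        = (\<Sum>\<phi>\<in>B. fst \<phi> * y \<phi>) + (\<Sum>\<phi>\<in>B. \<Sum>d\<in>D. u d * (snd \<phi> d * y \<phi>))"
      by (simp add: affine_eval_def distrib_left sum.distrib sum_distrib_left mult_ac)
    also have "(\<Sum>\<phi>\<in>B. \<Sum>d\<in>D. u d * (snd \<phi> d * y \<phi>)) = (\<Sum>d\<in>D. u d * (\<Sum>\<phi>\<in>B. snd \<phi> d * y \<phi>))"
      unfolding sum_distrib_left by (rule sum.swap)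
    finally show ?thesis using zero by (simp add: coeff_def)
  qed
  show ?thesis
  proof (cases "\<exists>\<phi>\<in>B. y \<phi> < 0")
    case True
    then show ?thesis using dependence by blast
  next
    case False
    then have "\<exists>\<phi>\<in>B. - y \<phi> < 0" using y by force
    then show ?thesis using dependence by (intro exI[of _ "\<lambda>\<phi>. - y \<phi>"]) (simp add: sum_negf)
  qed
qed

lemma card_shattered_nonneg_patterns:
  assumes "finite D" "finite B" "B \<subseteq> \<Phi>" and shattered: "shatters (nonneg_pattern D \<Phi> ` U) B"
  shows "card B \<le> card D + 1"
proof (rule ccontr)
  assume "\<not> card B \<le> card D + 1"
  then obtain z \<psi> where \<psi>: "\<psi> \<in> B" "z \<psi> < 0"
    and zero: "\<And>u. (\<Sum>\<phi>\<in>B. z \<phi> * affine_eval D \<phi> u) = 0"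
    using ex_affine_dependence[OF assms(1,2)] by auto
  have "{\<phi> \<in> B. 0 \<le> z \<phi>} \<subseteq> B" by blast
  then obtain u where "nonneg_pattern D \<Phi> u \<inter> B = {\<phi> \<in> B. 0 \<le> z \<phi>}"
    using shattered unfolding shatters_def by blast
  then have same_sign: "0 \<le> affine_eval D \<phi> u \<longleftrightarrow> 0 \<le> z \<phi>" if "\<phi> \<in> B" for \<phi>
    using that assms(3) by (auto simp: nonneg_pattern_def)
  have "0 < (\<Sum>\<phi>\<in>B. z \<phi> * affine_eval D \<phi> u)"
  proof (rule sum_pos2[OF assms(2) \<psi>(1)])
    show "0 < z \<psi> * affine_eval D \<psi> u"
      using same_sign[OF \<psi>(1)] \<psi>(2) by (intro mult_neg_neg) auto
    show "0 \<le> z \<phi> * affine_eval D \<phi> u" if "\<phi> \<in> B" for \<phi>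
      using same_sign[OF that] by (auto simp: zero_le_mult_iff)
  qed
  then show False by (simp add: zero)
qed

lemma card_nonneg_patterns:
  fixes x :: real
  assumes "finite D" "finite \<Phi>" "0 < x" "x \<le> 1"
  shows "real (card (nonneg_pattern D \<Phi> ` U)) \<le> (1 + x) ^ card \<Phi> / x ^ (card D + 1)"
proof -
  have small: "card B \<le> card D + 1" if "B \<subseteq> \<Phi>" "shatters (nonneg_pattern D \<Phi> ` U) B" for B
    by (rule card_shattered_nonneg_patterns[OF assms(1) finite_subset[OF that(1) assms(2)] that])
  have "card (nonneg_pattern D \<Phi> ` U) \<le> card {B. B \<subseteq> \<Phi> \<and> shatters (nonneg_pattern D \<Phi> ` U) B}"
    using assms by (intro card_le_card_shattered) (auto simp: nonneg_pattern_def)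
  also have "\<dots> \<le> card {B. B \<subseteq> \<Phi> \<and> card B \<le> card D + 1}"
    using small assms(2) by (intro card_mono) auto
  finally have "real (card (nonneg_pattern D \<Phi> ` U)) \<le> real (card {B. B \<subseteq> \<Phi> \<and> card B \<le> card D + 1})"
    by simp
  also have "\<dots> \<le> (1 + x) ^ card \<Phi> / x ^ (card D + 1)"
    using assms by (intro card_small_subsets)
  finally show ?thesis .
qed

lemma map_pmf_agreement_rademacher:
  assumes "\<sigma> \<in> {-1, 1}"
  shows "map_pmf (\<lambda>y. y = \<sigma>) rademacher = bernoulli_pmf (1 / 2)"
proof -
  have "inj_on (\<lambda>y. y = \<sigma>) {-1, 1}" "(\<lambda>y. y = \<sigma>) ` {-1, 1} = UNIV"
    using assms by (auto simp: inj_on_def UNIV_bool)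
  then show ?thesis
    by (simp add: rademacher_def map_pmf_of_set_inj bernoulli_pmf_half_conv_pmf_of_set)
qed

lemma map_pmf_card_agreements:
  assumes "finite I" "P \<subseteq> I" "\<And>i. \<sigma> i \<in> {-1, 1}"
  shows "map_pmf (\<lambda>\<eta>. card {i \<in> P. \<eta> i = \<sigma> i}) (rademacher_signs I)
    = binomial_pmf (card P) (1 / 2)"
proof -
  have finP: "finite P" using assms finite_subset by blast
  have "binomial_pmf (card P) (1 / 2)
      = map_pmf (\<lambda>f. card {i \<in> P. f i}) (Pi_pmf P False (\<lambda>_. bernoulli_pmf (1 / 2)))"
    by (rule binomial_pmf_altdef'[OF finP]) auto
  also have "Pi_pmf P False (\<lambda>_. bernoulli_pmf (1 / 2))
      = Pi_pmf P False (\<lambda>i. bind_pmf rademacher (\<lambda>y. return_pmf (y = \<sigma> i)))"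
    using map_pmf_agreement_rademacher[OF assms(3)] by (simp add: map_pmf_def)
  also have "\<dots> = map_pmf (\<lambda>\<eta> i. if i \<in> P then \<eta> i = \<sigma> i else False) (rademacher_signs P)"
    unfolding Pi_pmf_bind[OF finP, of _ _ _ 0] Pi_pmf_return_pmf[OF finP] map_pmf_def by (rule refl)
  also have "\<dots> = map_pmf (\<lambda>\<eta> i. if i \<in> P then \<eta> i = \<sigma> i else False) (rademacher_signs I)"
    by (simp add: Pi_pmf_subset[OF assms(1,2)] map_pmf_comp cong: if_cong)
  finally show ?thesis by (simp add: map_pmf_comp cong: conj_cong)
qed

lemma prob_few_agreements:
  fixes \<sigma> :: "'i \<Rightarrow> real" and s :: real
  assumes "finite I" "P \<subseteq> I" "s \<le> real (card P)" "\<And>i. \<sigma> i \<in> {-1, 1}"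
  shows "measure_pmf.prob (rademacher_signs I)
      {\<eta>. real (card {i \<in> P. \<eta> i = \<sigma> i}) < s / 8} \<le> exp (- s / 4)"
proof (cases "0 < s")
  case True
  define k where "k = card P"
  have k: "0 < k" "s \<le> real k" using True assms(3) by (auto simp: k_def)
  interpret binomial_distribution k "1 / 2" by unfold_locales simp
  have "measure_pmf.prob (rademacher_signs I) {\<eta>. real (card {i \<in> P. \<eta> i = \<sigma> i}) < s / 8}
      = measure_pmf.prob (binomial_pmf k (1 / 2)) {c. real c < s / 8}"
    unfolding k_def map_pmf_card_agreements[where \<sigma> = \<sigma>, OF assms(1,2,4), symmetric] measure_map_pmf
    by (simp add: vimage_def)
  also have "\<dots> \<le> measure_pmf.prob (binomial_pmf k (1 / 2))
      {c. real c \<le> real k * (1 / 2) - 3 / 8 * real k}"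
    using k by (intro measure_pmf.finite_measure_mono) auto
  also have "\<dots> \<le> exp (- 2 * (3 / 8 * real k)\<^sup>2 / real k)"
    using k by (intro prob_le) auto
  also have "\<dots> \<le> exp (- s / 4)"
    using k by (simp add: power2_eq_square field_simps)
  finally show ?thesis .
next
  case False
  then show ?thesis by (intro order_trans[OF measure_pmf.prob_le_1]) simp
qed

definition cancelling_signs ::
    "'d set \<Rightarrow> 'i set \<Rightarrow> ('i \<Rightarrow> 'd \<Rightarrow> real) \<Rightarrow> ('i \<Rightarrow> 'd \<Rightarrow> real) \<Rightarrow> real \<Rightarrow> real \<Rightarrow>
      ('d \<Rightarrow> real) \<Rightarrow> ('i \<Rightarrow> real) set" where
  "cancelling_signs D I f g \<beta> s u = {\<eta>. real (card {i \<in> I.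
    \<beta> \<le> \<bar>(\<Sum>d\<in>D. f i d * u d) + \<eta> i * (\<Sum>d\<in>D. g i d * u d)\<bar>}) < s}"

definition cancellation_functionals ::
    "'i set \<Rightarrow> ('i \<Rightarrow> 'd \<Rightarrow> real) \<Rightarrow> ('i \<Rightarrow> 'd \<Rightarrow> real) \<Rightarrow> real \<Rightarrow> (real \<times> ('d \<Rightarrow> real)) set" where
  "cancellation_functionals I f g \<beta> = (\<Union>i\<in>I. {(0, f i), (- \<beta>, g i), (- \<beta>, \<lambda>d. - g i d)})"

lemma card_cancellation_functionals_le:
  assumes "finite I"
  shows "card (cancellation_functionals I f g \<beta>) \<le> 3 * card I"
proof -
  have "card (cancellation_functionals I f g \<beta>)
      \<le> (\<Sum>i\<in>I. card {(0, f i), (- \<beta>, g i), (- \<beta>, \<lambda>d. - g i d)})"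
    unfolding cancellation_functionals_def by (rule card_UN_le[OF assms])
  also have "\<dots> \<le> (\<Sum>i\<in>I. 3)"
    by (intro sum_mono order_trans[OF card_length[of "[_, _, _]", simplified]]) simp
  finally show ?thesis by simp
qed

lemma mem_cancellation_pattern:
  fixes f g :: "'i \<Rightarrow> 'd \<Rightarrow> real" and \<beta> :: real
    and u :: "'d \<Rightarrow> real" and D :: "'d set" and I :: "'i set"
  assumes "i \<in> I"
  defines "Z \<equiv> nonneg_pattern D (cancellation_functionals I f g \<beta>) u"
  shows "(0, f i) \<in> Z \<longleftrightarrow> 0 \<le> (\<Sum>d\<in>D. f i d * u d)"
    and "(- \<beta>, g i) \<in> Z \<longleftrightarrow> \<beta> \<le> (\<Sum>d\<in>D. g i d * u d)"
    and "(- \<beta>, \<lambda>d. - g i d) \<in> Z \<longleftrightarrow> \<beta> \<le> - (\<Sum>d\<in>D. g i d * u d)"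
  using assms
  by (auto simp: nonneg_pattern_def affine_eval_def cancellation_functionals_def sum_negf)

definition large_indices ::
    "'i set \<Rightarrow> ('i \<Rightarrow> 'd \<Rightarrow> real) \<Rightarrow> real \<Rightarrow> (real \<times> ('d \<Rightarrow> real)) set \<Rightarrow> 'i set" where
  "large_indices I g \<beta> Z = {i \<in> I. (- \<beta>, g i) \<in> Z \<or> (- \<beta>, \<lambda>d. - g i d) \<in> Z}"

definition noncancelling_sign ::
    "('i \<Rightarrow> 'd \<Rightarrow> real) \<Rightarrow> ('i \<Rightarrow> 'd \<Rightarrow> real) \<Rightarrow> real \<Rightarrow> (real \<times> ('d \<Rightarrow> real)) set \<Rightarrow> 'i \<Rightarrow> real" where
  "noncancelling_sign f g \<beta> Z i = (if (0, f i) \<in> Z \<longleftrightarrow> (- \<beta>, g i) \<in> Z then 1 else - 1)"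

lemma large_indices_nonneg_pattern:
  assumes "0 < \<beta>"
  shows "large_indices I g \<beta> (nonneg_pattern D (cancellation_functionals I f g \<beta>) u)
    = {i \<in> I. \<beta> \<le> \<bar>\<Sum>d\<in>D. g i d * u d\<bar>}"
  using assms by (auto simp: large_indices_def mem_cancellation_pattern)

lemma cancelling_signs_subset_few_agreements:
  fixes f g :: "'i \<Rightarrow> 'd \<Rightarrow> real" and \<beta> :: real
    and u :: "'d \<Rightarrow> real" and D :: "'d set" and I :: "'i set"
  assumes "finite I" "0 < \<beta>"
  defines "Z \<equiv> nonneg_pattern D (cancellation_functionals I f g \<beta>) u"
  shows "cancelling_signs D I f g \<beta> s u
    \<subseteq> {\<eta>. real (card {i \<in> large_indices I g \<beta> Z. \<eta> i = noncancelling_sign f g \<beta> Z i}) < s}"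
proof
  fix \<eta> assume \<eta>: "\<eta> \<in> cancelling_signs D I f g \<beta> s u"
  have "{i \<in> large_indices I g \<beta> Z. \<eta> i = noncancelling_sign f g \<beta> Z i}
      \<subseteq> {i \<in> I. \<beta> \<le> \<bar>(\<Sum>d\<in>D. f i d * u d) + \<eta> i * (\<Sum>d\<in>D. g i d * u d)\<bar>}"
    using \<open>0 < \<beta>\<close> unfolding Z_def large_indices_nonneg_pattern[OF \<open>0 < \<beta>\<close>]
    by (auto simp: noncancelling_sign_def mem_cancellation_pattern)
  then have "card {i \<in> large_indices I g \<beta> Z. \<eta> i = noncancelling_sign f g \<beta> Z i}
      \<le> card {i \<in> I. \<beta> \<le> \<bar>(\<Sum>d\<in>D. f i d * u d) + \<eta> i * (\<Sum>d\<in>D. g i d * u d)\<bar>}"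
    using assms(1) by (intro card_mono) auto
  then show "\<eta> \<in> {\<eta>. real (card {i \<in> large_indices I g \<beta> Z.
      \<eta> i = noncancelling_sign f g \<beta> Z i}) < s}"
    using \<eta> by (simp add: cancelling_signs_def)
qed

text \<open>The sign of \<open>\<eta> i\<close> for which the two terms do not cancel is a function of the sign pattern
  of affine functionals of \<open>u\<close>, so it takes few values over all \<open>u\<close>, however small \<open>\<beta>\<close> is.\<close>

lemma prob_cancelling_signs_le:
  fixes f g :: "'i \<Rightarrow> 'd \<Rightarrow> real" and \<beta> s x :: real
  assumes "finite I" "finite D" and x: "0 < x" "x \<le> 1" and "0 < \<beta>"
    and large: "\<And>u. u \<in> U \<Longrightarrow> s \<le> real (card {i \<in> I. \<beta> \<le> \<bar>\<Sum>d\<in>D. g i d * u d\<bar>})"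
  shows "measure_pmf.prob (rademacher_signs I) (\<Union>u\<in>U. cancelling_signs D I f g \<beta> (s / 8) u)
    \<le> (1 + x) ^ (3 * card I) / x ^ (card D + 1) * exp (- s / 4)"
proof -
  let ?prob = "measure_pmf.prob (rademacher_signs I)"
  define \<Phi> where "\<Phi> = cancellation_functionals I f g \<beta>"
  define few where "few Z = {\<eta>. real (card {i \<in> large_indices I g \<beta> Z.
    \<eta> i = noncancelling_sign f g \<beta> Z i}) < s / 8}" for Z
  have fin: "finite \<Phi>" using assms(1) by (simp add: \<Phi>_def cancellation_functionals_def)
  then have finU: "finite (nonneg_pattern D \<Phi> ` U)"
    by (rule finite_subset[of _ "Pow \<Phi>", rotated, OF finite_Pow_iff[THEN iffD2]])
      (auto simp: nonneg_pattern_def)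
  have "cancelling_signs D I f g \<beta> (s / 8) u \<subseteq> few (nonneg_pattern D \<Phi> u)" for u
    unfolding few_def \<Phi>_def by (rule cancelling_signs_subset_few_agreements[OF assms(1) \<open>0 < \<beta>\<close>])
  then have "?prob (\<Union>u\<in>U. cancelling_signs D I f g \<beta> (s / 8) u)
      \<le> ?prob (\<Union>Z\<in>nonneg_pattern D \<Phi> ` U. few Z)"
    by (intro measure_pmf.finite_measure_mono) (auto simp: subset_eq)
  also have "\<dots> \<le> (\<Sum>Z\<in>nonneg_pattern D \<Phi> ` U. ?prob (few Z))"
    using finU by (intro measure_UNION_le) auto
  also have "\<dots> \<le> (\<Sum>Z\<in>nonneg_pattern D \<Phi> ` U. exp (- s / 4))"
    unfolding few_def \<Phi>_def using large assms(1)
    by (intro sum_mono prob_few_agreements)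
      (auto simp: noncancelling_sign_def large_indices_nonneg_pattern[OF \<open>0 < \<beta>\<close>])
  also have "\<dots> = real (card (nonneg_pattern D \<Phi> ` U)) * exp (- s / 4)" by simp
  also have "\<dots> \<le> (1 + x) ^ card \<Phi> / x ^ (card D + 1) * exp (- s / 4)"
    by (intro mult_right_mono card_nonneg_patterns fin assms(2) x) simp
  also have "\<dots> \<le> (1 + x) ^ (3 * card I) / x ^ (card D + 1) * exp (- s / 4)"
    unfolding \<Phi>_def using x
    by (intro mult_right_mono divide_right_mono power_increasing
        card_cancellation_functionals_le assms(1)) auto
  finally show ?thesis .
qed

lemma prob_cancelling_signs_supported_le:
  fixes f g :: "'i \<Rightarrow> 'd \<Rightarrow> real" and \<beta> s x :: real
  assumes "finite I" "finite D" and x: "0 < x" "x \<le> 1" and "0 < \<beta>"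
    and S: "S \<subseteq> D" "card S \<le> m" and supported: "\<And>u. u \<in> U \<Longrightarrow> {d \<in> D. u d \<noteq> 0} = S"
    and large: "\<And>u. u \<in> U \<Longrightarrow> s \<le> real (card {i \<in> I. \<beta> \<le> \<bar>\<Sum>d\<in>D. g i d * u d\<bar>})"
  shows "measure_pmf.prob (rademacher_signs I) (\<Union>u\<in>U. cancelling_signs D I f g \<beta> (s / 8) u)
    \<le> (1 + x) ^ (3 * card I) / x ^ (m + 1) * exp (- s / 4)"
proof -
  have sums: "(\<Sum>d\<in>D. h d * u d) = (\<Sum>d\<in>S. h d * u d)" if "u \<in> U" for h u
    using supported[OF that] assms(2) by (intro sum.mono_neutral_right) auto
  have "measure_pmf.prob (rademacher_signs I) (\<Union>u\<in>U. cancelling_signs S I f g \<beta> (s / 8) u)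
      \<le> (1 + x) ^ (3 * card I) / x ^ (card S + 1) * exp (- s / 4)"
    using large sums finite_subset[OF S(1) assms(2)]
    by (intro prob_cancelling_signs_le assms(1) x \<open>0 < \<beta>\<close>) simp_all
  also have "\<dots> \<le> (1 + x) ^ (3 * card I) / x ^ (m + 1) * exp (- s / 4)"
    using S(2) x by (intro mult_right_mono divide_left_mono power_decreasing) auto
  finally show ?thesis using sums by (simp add: cancelling_signs_def cong: SUP_cong)
qed

lemma prob_cancelling_signs_sparse_le:
  fixes f g :: "'i \<Rightarrow> 'd \<Rightarrow> real" and \<beta> s x :: real
  assumes "finite I" "finite D" and x: "0 < x" "x \<le> 1" and "0 < \<beta>"
    and sparse: "\<And>u. u \<in> U \<Longrightarrow> card {d \<in> D. u d \<noteq> 0} \<le> m"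
    and large: "\<And>u. u \<in> U \<Longrightarrow> s \<le> real (card {i \<in> I. \<beta> \<le> \<bar>\<Sum>d\<in>D. g i d * u d\<bar>})"
  shows "measure_pmf.prob (rademacher_signs I) (\<Union>u\<in>U. cancelling_signs D I f g \<beta> (s / 8) u)
    \<le> (1 + x) ^ (card D + 3 * card I) / x ^ (2 * m + 1) * exp (- s / 4)"
proof -
  let ?prob = "measure_pmf.prob (rademacher_signs I)" and ?C = "cancelling_signs D I f g \<beta> (s / 8)"
  define \<S> where "\<S> = {S. S \<subseteq> D \<and> card S \<le> m}"
  define supported where "supported S = {u \<in> U. {d \<in> D. u d \<noteq> 0} = S}" for S
  have "U = (\<Union>S\<in>\<S>. supported S)"
    using sparse by (auto simp: supported_def \<S>_def)
  then have "?prob (\<Union>u\<in>U. ?C u) = ?prob (\<Union>S\<in>\<S>. \<Union>u\<in>supported S. ?C u)" by (metis UN_UN_flatten)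
  also have "\<dots> \<le> (\<Sum>S\<in>\<S>. ?prob (\<Union>u\<in>supported S. ?C u))"
    using assms(2) by (intro measure_UNION_le) (auto simp: \<S>_def)
  also have "\<dots> \<le> (\<Sum>S\<in>\<S>. (1 + x) ^ (3 * card I) / x ^ (m + 1) * exp (- s / 4))"
    using large
    by (intro sum_mono prob_cancelling_signs_supported_le assms(1,2) x \<open>0 < \<beta>\<close>)
      (auto simp: \<S>_def supported_def)
  also have "\<dots> = real (card \<S>) * ((1 + x) ^ (3 * card I) / x ^ (m + 1) * exp (- s / 4))" by simp
  also have "\<dots> \<le> (1 + x) ^ card D / x ^ m * ((1 + x) ^ (3 * card I) / x ^ (m + 1) * exp (- s / 4))"
    using card_small_subsets[OF assms(2) x, of m] x by (intro mult_right_mono) (auto simp: \<S>_def)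
  also have "\<dots> = (1 + x) ^ (card D + 3 * card I) / x ^ (2 * m + 1) * exp (- s / 4)"
    unfolding mult_2 power_add by (simp add: mult_ac)
  finally show ?thesis .
qed

subsection \<open>Compressible vectors and column normals\<close>

lemma l2_norm_conv_L2_set:
  assumes "x \<in> carrier_vec n"
  shows "l2_norm x = L2_set (($) x) {..<n}"
  using assms
  by (simp add: l2_norm_def L2_set_def scalar_prod_def power2_eq_square lessThan_atLeast0)

lemma l2_norm_nonneg [simp]: "0 \<le> l2_norm x"
  using l2_norm_conv_L2_set[of x "dim_vec x"] by simp

lemma power2_l2_norm:
  assumes "x \<in> carrier_vec n"
  shows "(l2_norm x)\<^sup>2 = (\<Sum>i<n. (x $ i)\<^sup>2)"
  unfolding l2_norm_conv_L2_set[OF assms] by (simp add: L2_set_def sum_nonneg)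

lemma l2_norm_eq_0_iff:
  assumes "x \<in> carrier_vec n"
  shows "l2_norm x = 0 \<longleftrightarrow> x = 0\<^sub>v n"
  using assms unfolding l2_norm_conv_L2_set[OF assms]
  by (auto simp: L2_set_eq_0_iff intro!: eq_vecI)

lemma l2_norm_smult: "l2_norm (c \<cdot>\<^sub>v x) = \<bar>c\<bar> * l2_norm x"
  by (simp add: l2_norm_def real_sqrt_mult power2_eq_square[symmetric] flip: mult.assoc)

lemma l2_norm_add_le:
  assumes "x \<in> carrier_vec n" "y \<in> carrier_vec n"
  shows "l2_norm (x + y) \<le> l2_norm x + l2_norm y"
proof -
  have "l2_norm (x + y) = L2_set (\<lambda>i. x $ i + y $ i) {..<n}"
    unfolding l2_norm_conv_L2_set[OF add_carrier_vec[OF assms]]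
    using assms by (intro L2_set_cong) auto
  then show ?thesis
    using L2_set_triangle_ineq[of "($) x" "($) y" "{..<n}"] assms
    by (simp add: l2_norm_conv_L2_set)
qed

lemma abs_scalar_prod_le:
  assumes "x \<in> carrier_vec n" "y \<in> carrier_vec n"
  shows "\<bar>x \<bullet> y\<bar> \<le> l2_norm x * l2_norm y"
proof -
  have "\<bar>x \<bullet> y\<bar> \<le> (\<Sum>i<n. \<bar>x $ i\<bar> * \<bar>y $ i\<bar>)"
    using assms sum_abs[of "\<lambda>i. x $ i * y $ i" "{..<n}"]
    by (simp add: scalar_prod_def lessThan_atLeast0 abs_mult)
  also have "\<dots> \<le> L2_set (($) x) {..<n} * L2_set (($) y) {..<n}" by (rule L2_set_mult_ineq)
  finally show ?thesis using assms by (simp add: l2_norm_conv_L2_set)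
qed

lemma card_large_coordinates_le:
  assumes "x \<in> carrier_vec n" "0 \<le> t"
  shows "real (card {i. i < n \<and> t \<le> \<bar>x $ i\<bar>}) * t\<^sup>2 \<le> (l2_norm x)\<^sup>2"
proof -
  have "real (card {i. i < n \<and> t \<le> \<bar>x $ i\<bar>}) * t\<^sup>2 = (\<Sum>i | i < n \<and> t \<le> \<bar>x $ i\<bar>. t\<^sup>2)"
    by simp
  also have "\<dots> \<le> (\<Sum>i | i < n \<and> t \<le> \<bar>x $ i\<bar>. (x $ i)\<^sup>2)"
    using assms(2) by (intro sum_mono) (simp add: abs_le_square_iff[symmetric])
  also have "\<dots> \<le> (\<Sum>i<n. (x $ i)\<^sup>2)" by (rule sum_mono2) auto
  finally show ?thesis by (simp add: power2_l2_norm[OF assms(1)])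
qed

lemma normalize_in_unit_sphere:
  assumes "x \<in> carrier_vec n" "x \<noteq> 0\<^sub>v n"
  shows "(1 / l2_norm x) \<cdot>\<^sub>v x \<in> unit_sphere n"
  using assms by (simp add: unit_sphere_def l2_norm_smult l2_norm_eq_0_iff)

lemma l2_norm_mult_mat_vec_le:
  assumes A: "A \<in> carrier_mat m n" and x: "x \<in> carrier_vec n"
  shows "l2_norm (A *\<^sub>v x) \<le> spectral_norm A * l2_norm x"
proof (cases "x = 0\<^sub>v n")
  case True
  then have "A *\<^sub>v x = 0\<^sub>v m" using A by (intro eq_vecI) auto
  then show ?thesis using True by (simp add: l2_norm_def)
next
  case False
  have "bdd_above ((\<lambda>x. l2_norm (A *\<^sub>v x)) ` unit_sphere n)"
  proof (rule bdd_aboveI2)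
    fix x assume "x \<in> unit_sphere n"
    then have x: "x \<in> carrier_vec n" "l2_norm x = 1" by (auto simp: unit_sphere_def)
    have "A *\<^sub>v x \<in> carrier_vec m" using A x(1) by simp
    then have "l2_norm (A *\<^sub>v x) \<le> (\<Sum>j<m. \<bar>(A *\<^sub>v x) $ j\<bar>)"
      using L2_set_le_sum_abs[of "($) (A *\<^sub>v x)"] by (simp only: l2_norm_conv_L2_set)
    also have "\<dots> \<le> (\<Sum>j<m. l2_norm (row A j))"
    proof (rule sum_mono)
      show "\<bar>(A *\<^sub>v x) $ j\<bar> \<le> l2_norm (row A j)" if "j \<in> {..<m}" for j
        using abs_scalar_prod_le[of "row A j" n x] A x that by simp
    qed
    finally show "l2_norm (A *\<^sub>v x) \<le> (\<Sum>j<m. l2_norm (row A j))" .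
  qed
  then have "l2_norm (A *\<^sub>v ((1 / l2_norm x) \<cdot>\<^sub>v x)) \<le> spectral_norm A"
    unfolding spectral_norm_def using A normalize_in_unit_sphere[OF x False]
    by (intro cSUP_upper) auto
  moreover have "0 < l2_norm x" using False x by (simp add: l2_norm_eq_0_iff less_le)
  ultimately show ?thesis
    using A x by (simp add: mult_mat_vec l2_norm_smult field_simps)
qed

lemma l2_norm_mult_transpose_le:
  assumes A: "A \<in> carrier_mat m n"
    and bound: "\<And>x. x \<in> carrier_vec n \<Longrightarrow> l2_norm (A *\<^sub>v x) \<le> c * l2_norm x"
    and "0 \<le> c" and y: "y \<in> carrier_vec m"
  shows "l2_norm (A\<^sup>T *\<^sub>v y) \<le> c * l2_norm y"
proof (cases "l2_norm (A\<^sup>T *\<^sub>v y) = 0")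
  case False
  define z where "z = A\<^sup>T *\<^sub>v y"
  have z: "z \<in> carrier_vec n" using A y by (simp add: z_def)
  have Az: "A *\<^sub>v z \<in> carrier_vec m" using A z by simp
  have "(l2_norm z)\<^sup>2 = z \<bullet> z"
    unfolding power2_l2_norm[OF z] using z
    by (simp add: scalar_prod_def lessThan_atLeast0 power2_eq_square)
  also have "\<dots> = y \<bullet> (A *\<^sub>v z)" using transpose_vec_mult_scalar[OF A z y] by (simp add: z_def)
  also have "\<dots> \<le> l2_norm y * l2_norm (A *\<^sub>v z)"
    using abs_scalar_prod_le[OF y Az] by simp
  also have "\<dots> \<le> l2_norm y * (c * l2_norm z)" by (intro mult_left_mono bound z) simp
  finally have "l2_norm z * l2_norm z \<le> (c * l2_norm y) * l2_norm z"
    by (simp add: power2_eq_square mult_ac)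
  moreover have "0 < l2_norm z" using False by (simp add: z_def less_le)
  ultimately show ?thesis by (simp add: z_def)
qed (use assms in simp)

lemma l2_norm_mat_diag_mult:
  assumes "\<And>i. i < n \<Longrightarrow> \<bar>f i\<bar> = 1" "x \<in> carrier_vec n"
  shows "l2_norm (mat_diag n f *\<^sub>v x) = l2_norm x"
proof -
  have "(mat_diag n f *\<^sub>v x) $ i = f i * x $ i" if "i < n" for i
    using that assms(2)
    by (simp add: mat_diag_def scalar_prod_def if_distrib[of "\<lambda>c. c * _"] cong: if_cong)
  moreover have "(f i)\<^sup>2 = 1" if "i < n" for i
    using assms(1)[OF that] by (simp add: abs_square_eq_1)
  moreover have "mat_diag n f *\<^sub>v x \<in> carrier_vec n"
    using mult_mat_vec_carrier[OF mat_diag_dim assms(2)] .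
  ultimately have "(l2_norm (mat_diag n f *\<^sub>v x))\<^sup>2 = (l2_norm x)\<^sup>2"
    using assms(2) by (simp add: power2_l2_norm power_mult_distrib)
  then show ?thesis by simp
qed

lemma l2_norm_sparse_mult_le:
  assumes B: "B \<in> carrier_mat m n" and x: "x \<in> carrier_vec n"
    and entries: "\<And>j i. j < m \<Longrightarrow> i < n \<Longrightarrow> \<bar>B $$ (j, i)\<bar> \<le> b"
    and rows: "\<And>j. j < m \<Longrightarrow> card {i. i < n \<and> B $$ (j, i) \<noteq> 0} \<le> L"
    and cols: "\<And>i. i < n \<Longrightarrow> card {j. j < m \<and> B $$ (j, i) \<noteq> 0} \<le> K" and "0 \<le> b"
  shows "l2_norm (B *\<^sub>v x) \<le> b * sqrt (real K * real L) * l2_norm x"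
proof -
  define N where "N j = {i. i < n \<and> B $$ (j, i) \<noteq> 0}" for j
  have row: "((B *\<^sub>v x) $ j)\<^sup>2 \<le> real L * b\<^sup>2 * (\<Sum>i<n. of_bool (B $$ (j, i) \<noteq> 0) * (x $ i)\<^sup>2)"
    if j: "j < m" for j
  proof -
    have "(B *\<^sub>v x) $ j = (\<Sum>i<n. B $$ (j, i) * x $ i)"
      using B x j by (simp add: scalar_prod_def lessThan_atLeast0)
    also have "\<dots> = (\<Sum>i\<in>N j. B $$ (j, i) * x $ i)"
      by (intro sum.mono_neutral_right) (auto simp: N_def)
    finally have "((B *\<^sub>v x) $ j)\<^sup>2 \<le> (\<Sum>i\<in>N j. (B $$ (j, i))\<^sup>2) * (\<Sum>i\<in>N j. (x $ i)\<^sup>2)"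
      by (simp only: Cauchy_Schwarz_ineq_sum)
    also have "\<dots> \<le> (real (card (N j)) * b\<^sup>2) * (\<Sum>i\<in>N j. (x $ i)\<^sup>2)"
      using entries j by (intro mult_right_mono sum_bounded_above sum_nonneg)
        (auto simp: N_def abs_le_square_iff[symmetric] abs_of_nonneg[OF \<open>0 \<le> b\<close>])
    also have "\<dots> \<le> (real L * b\<^sup>2) * (\<Sum>i\<in>N j. (x $ i)\<^sup>2)"
      using rows[OF j] by (intro mult_right_mono sum_nonneg) (auto simp: N_def)
    also have "(\<Sum>i\<in>N j. (x $ i)\<^sup>2) = (\<Sum>i<n. of_bool (B $$ (j, i) \<noteq> 0) * (x $ i)\<^sup>2)"
      by (intro sum.mono_neutral_cong_left) (auto simp: N_def)
    finally show ?thesis .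
  qed
  have "(l2_norm (B *\<^sub>v x))\<^sup>2 = (\<Sum>j<m. ((B *\<^sub>v x) $ j)\<^sup>2)"
    using B x by (intro power2_l2_norm) simp
  also have "\<dots> \<le> (\<Sum>j<m. real L * b\<^sup>2 * (\<Sum>i<n. of_bool (B $$ (j, i) \<noteq> 0) * (x $ i)\<^sup>2))"
    using row by (intro sum_mono) simp
  also have "\<dots> = real L * b\<^sup>2 * (\<Sum>i<n. (\<Sum>j<m. of_bool (B $$ (j, i) \<noteq> 0)) * (x $ i)\<^sup>2)"
    unfolding sum_distrib_left[symmetric] sum_distrib_right by (subst sum.swap) (rule refl)
  also have "\<dots> \<le> real L * b\<^sup>2 * (\<Sum>i<n. real K * (x $ i)\<^sup>2)"
    using cols by (intro mult_left_mono sum_mono mult_right_mono) (auto simp: Int_def)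
  also have "\<dots> = (b * sqrt (real K * real L) * l2_norm x)\<^sup>2"
    by (simp add: power2_l2_norm[OF x] power_mult_distrib sum_distrib_left mult_ac)
  finally show ?thesis
    using \<open>0 \<le> b\<close> by (simp add: power2_le_iff_abs_le abs_mult)
qed

lemma Comp_if_near_sparse:
  assumes v: "v \<in> unit_sphere n" and y: "y \<in> carrier_vec n"
    and sparse: "real (num_nonzero y) \<le> \<alpha> * real n"
    and near: "l2_norm (v - y) \<le> \<nu> / 2" and "\<nu> < 2"
  shows "v \<in> Comp n \<alpha> \<nu>"
proof -
  define q where "q = l2_norm y"
  define w where "w = (1 / q) \<cdot>\<^sub>v y"
  have vc: "v \<in> carrier_vec n" and v1: "l2_norm v = 1" using v by (auto simp: unit_sphere_def)
  have vy: "v = y + (v - y)" "y = v + (-1) \<cdot>\<^sub>v (v - y)" using vc y by (auto intro!: eq_vecI)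
  have "1 \<le> q + l2_norm (v - y)" "q \<le> 1 + l2_norm (v - y)"
    using l2_norm_add_le[of y n "v - y"] l2_norm_add_le[of v n "(-1) \<cdot>\<^sub>v (v - y)"] vy vc y v1
    by (simp_all add: q_def l2_norm_smult)
  then have q: "\<bar>1 - q\<bar> \<le> \<nu> / 2" "0 < q" using near \<open>\<nu> < 2\<close> by linarith+
  then have w: "w \<in> unit_sphere n"
    unfolding w_def q_def using y by (intro normalize_in_unit_sphere) (auto simp: q_def l2_norm_def)
  have "{i. i < dim_vec w \<and> w $ i \<noteq> 0} = {i. i < dim_vec y \<and> y $ i \<noteq> 0}"
    using q by (auto simp: w_def)
  then have sparse_w: "real (num_nonzero w) \<le> \<alpha> * real n"
    using sparse by (simp add: num_nonzero_def)
  have "v - w = (v - y) + (1 - 1 / q) \<cdot>\<^sub>v y"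
    using vc y by (auto intro!: eq_vecI simp: w_def algebra_simps)
  then have "l2_norm (v - w) \<le> l2_norm (v - y) + \<bar>1 - 1 / q\<bar> * q"
    using l2_norm_add_le[of "v - y" n "(1 - 1 / q) \<cdot>\<^sub>v y"] vc y by (simp add: l2_norm_smult q_def)
  also have "\<bar>1 - 1 / q\<bar> * q = \<bar>1 - q\<bar>"
    using q by (simp add: abs_if field_simps)
  finally have "l2_norm (v - w) \<le> \<nu>" using near q(1) by linarith
  then show ?thesis using v w sparse_w by (auto simp: Comp_def)
qed

lemma Incomp_many_large_coordinates:
  assumes v: "v \<in> Incomp n \<alpha> \<nu>" and \<nu>: "0 < \<nu>" "\<nu> < 2"
  shows "\<alpha> * real n < real (card {i. i < n \<and> \<nu> / (2 * sqrt (real n)) \<le> \<bar>v $ i\<bar>})"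
proof (rule ccontr)
  define T where "T = {i. i < n \<and> \<nu> / (2 * sqrt (real n)) \<le> \<bar>v $ i\<bar>}"
  define y where "y = Matrix.vec n (\<lambda>i. if i \<in> T then v $ i else 0)"
  assume "\<not> ?thesis"
  then have "real (card T) \<le> \<alpha> * real n" by (simp add: T_def)
  moreover have "num_nonzero y \<le> card T"
    unfolding num_nonzero_def by (rule card_mono) (auto simp: y_def T_def split: if_splits)
  ultimately have sparse: "real (num_nonzero y) \<le> \<alpha> * real n" by linarith
  have vs: "v \<in> unit_sphere n" and vc: "v \<in> carrier_vec n"
    using v by (auto simp: Incomp_def unit_sphere_def)
  have "(l2_norm (v - y))\<^sup>2 = (\<Sum>i<n. ((v - y) $ i)\<^sup>2)"
    using vc by (intro power2_l2_norm) (simp add: y_def)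
  also have "\<dots> \<le> (\<Sum>i<n. (\<nu> / (2 * sqrt (real n)))\<^sup>2)"
  proof (rule sum_mono)
    fix i assume "i \<in> {..<n}"
    then have "\<bar>(v - y) $ i\<bar> \<le> \<bar>\<nu> / (2 * sqrt (real n))\<bar>"
      using \<nu> vc by (auto simp: y_def T_def)
    then show "((v - y) $ i)\<^sup>2 \<le> (\<nu> / (2 * sqrt (real n)))\<^sup>2" by (simp only: abs_le_square_iff)
  qed
  also have "\<dots> \<le> (\<nu> / 2)\<^sup>2" by (cases "n = 0") (simp_all add: power_divide power_mult_distrib)
  finally have near: "l2_norm (v - y) \<le> \<nu> / 2"
    using \<nu> by (simp add: power2_le_iff_abs_le)
  have "v \<in> Comp n \<alpha> \<nu>"
    by (rule Comp_if_near_sparse[OF vs _ sparse near \<nu>(2)]) (simp add: y_def)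
  then show False using v by (simp add: Incomp_def)
qed

lemma col_scalar_prod_sum:
  assumes "M \<in> carrier_mat m n" "i < n" "u \<in> carrier_vec m"
  shows "col M i \<bullet> u = (\<Sum>j<m. M $$ (j, i) * u $ j)"
  using assms by (simp add: scalar_prod_def lessThan_atLeast0)

definition column_normal :: "real Matrix.mat \<Rightarrow> nat \<Rightarrow> real Matrix.vec \<Rightarrow> bool" where
  "column_normal M i u \<longleftrightarrow>
    u \<in> unit_sphere (dim_row M) \<and> (\<forall>i'<dim_col M. i' \<noteq> i \<longrightarrow> col M i' \<bullet> u = 0)"

lemma ex_column_normal:
  assumes M: "M \<in> carrier_mat n n" and "i < n"
  shows "\<exists>u. column_normal M i u"
proof -
  have "card ({..<n} - {i}) < card {..<n}" using assms(2) by simp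
  then obtain x where x: "\<exists>j<n. x j \<noteq> 0" "\<forall>i'\<in>{..<n} - {i}. (\<Sum>j<n. M $$ (j, i') * x j) = 0"
    using ex_nontrivial_solution[of "{..<n} - {i}" "{..<n}" "\<lambda>i' j. M $$ (j, i')"] by auto
  define y where "y = Matrix.vec n x"
  have y: "y \<in> carrier_vec n" "y \<noteq> 0\<^sub>v n" using x(1) by (auto simp: y_def vec_eq_iff)
  have "col M i' \<bullet> y = 0" if "i' < n" "i' \<noteq> i" for i'
    using x(2) that col_scalar_prod_sum[OF M _ y(1)] by (simp add: y_def)
  then have "column_normal M i ((1 / l2_norm y) \<cdot>\<^sub>v y)"
    using normalize_in_unit_sphere[OF y] M y(1) by (simp add: column_normal_def)
  then show ?thesis by blast
qed

lemma column_normal_bound: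
  assumes M: "M \<in> carrier_mat n n" and v: "v \<in> carrier_vec n" and "i < n"
    and u: "column_normal M i u"
  shows "\<bar>v $ i\<bar> * \<bar>col M i \<bullet> u\<bar> \<le> l2_norm (M *\<^sub>v v)"
proof -
  have uc: "u \<in> carrier_vec n" and u1: "l2_norm u = 1"
    using u M by (auto simp: column_normal_def unit_sphere_def)
  have "u \<bullet> (M *\<^sub>v v) = (M\<^sup>T *\<^sub>v u) \<bullet> v" using transpose_vec_mult_scalar[OF M v uc] by simp
  also have "\<dots> = (\<Sum>i'<n. (col M i' \<bullet> u) * v $ i')"
    using M v by (simp add: scalar_prod_def[of _ v] lessThan_atLeast0)
  also have "\<dots> = (\<Sum>i'<n. if i' = i then (col M i \<bullet> u) * v $ i else 0)"
    using u M by (intro sum.cong) (auto simp: column_normal_def)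
  also have "\<dots> = (col M i \<bullet> u) * v $ i" using \<open>i < n\<close> by simp
  finally show ?thesis
    using abs_scalar_prod_le[OF uc, of "M *\<^sub>v v"] M v by (simp add: u1 abs_mult mult.commute)
qed

definition spreads_sparse :: "real Matrix.mat \<Rightarrow> real \<Rightarrow> real \<Rightarrow> real \<Rightarrow> bool" where
  "spreads_sparse M \<alpha> t s \<longleftrightarrow> (\<forall>u\<in>unit_sphere (dim_row M).
    real (num_nonzero u) \<le> \<alpha> * real (dim_row M) \<longrightarrow>
    s \<le> real (card {i. i < dim_col M \<and> t \<le> \<bar>col M i \<bullet> u\<bar>}))"

lemma column_normal_Incomp:
  assumes M: "M \<in> carrier_mat n n" and u: "column_normal M i u"
    and spreads: "spreads_sparse M \<alpha> t s"
    and bound: "\<And>y. y \<in> carrier_vec n \<Longrightarrow> l2_norm (M\<^sup>T *\<^sub>v y) \<le> B * l2_norm y"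
    and "0 \<le> t" "0 \<le> B" and gap: "(B * \<nu>)\<^sup>2 < (s - 1) * t\<^sup>2"
  shows "u \<in> Incomp n \<alpha> \<nu>"
proof (rule ccontr)
  have us: "u \<in> unit_sphere n" and uc: "u \<in> carrier_vec n"
    using u M by (auto simp: column_normal_def unit_sphere_def)
  assume "u \<notin> Incomp n \<alpha> \<nu>"
  then obtain w where w: "w \<in> unit_sphere n" "real (num_nonzero w) \<le> \<alpha> * real n"
      "l2_norm (u - w) \<le> \<nu>"
    using us by (auto simp: Incomp_def Comp_def)
  then have wc: "w \<in> carrier_vec n" by (simp add: unit_sphere_def)
  define W where "W = {i'. i' < n \<and> t \<le> \<bar>(M\<^sup>T *\<^sub>v (u - w)) $ i'\<bar>}"
  have "\<bar>(M\<^sup>T *\<^sub>v (u - w)) $ i'\<bar> = \<bar>col M i' \<bullet> w\<bar>" if "i' < n" "i' \<noteq> i" for i'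
  proof -
    have "(M\<^sup>T *\<^sub>v (u - w)) $ i' = col M i' \<bullet> u - col M i' \<bullet> w"
      using that M scalar_prod_minus_distrib[OF _ uc wc, of "col M i'"] by (simp add: carrier_vecI)
    then show ?thesis using that u M by (simp add: column_normal_def)
  qed
  then have "{i'. i' < n \<and> t \<le> \<bar>col M i' \<bullet> w\<bar>} \<subseteq> insert i W"
    by (auto simp: W_def)
  then have "card {i'. i' < n \<and> t \<le> \<bar>col M i' \<bullet> w\<bar>} \<le> card (insert i W)"
    by (intro card_mono) (simp_all add: W_def)
  also have "\<dots> \<le> card W + 1" by (simp add: card_insert_if W_def)
  finally have "s - 1 \<le> real (card W)"
    using spreads w(1,2) M by (force simp: spreads_sparse_def)
  then have "(s - 1) * t\<^sup>2 \<le> real (card W) * t\<^sup>2" by (rule mult_right_mono) simp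
  also have "\<dots> \<le> (l2_norm (M\<^sup>T *\<^sub>v (u - w)))\<^sup>2"
    unfolding W_def using M uc wc by (intro card_large_coordinates_le \<open>0 \<le> t\<close>) simp
  also have "\<dots> \<le> (B * l2_norm (u - w))\<^sup>2"
    using uc wc by (intro power_mono bound) auto
  also have "\<dots> \<le> (B * \<nu>)\<^sup>2" using w(3) \<open>0 \<le> B\<close> by (intro power_mono mult_left_mono) auto
  finally show False using gap by simp
qed

subsection \<open>The perturbation matrices\<close>

lemma R1_carrier [simp]: "R1 n \<rho> V \<omega> \<in> carrier_mat n n"
  by (cases \<omega>) (auto simp: R1_def mat_diag_def intro!: carrier_matI)

lemma R2_carrier [simp]: "R2 n K L \<omega> \<in> carrier_mat n n"
  by (cases \<omega>) (simp add: R2_def hadamard_prod_def H_trunc_def)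

lemma R1_index:
  assumes "V \<in> carrier_mat n n" "j < n" "i < n"
  shows "R1 n \<rho> V (\<eta>, J, X) $$ (j, i) = \<eta> (1, j) * V $$ (j, i) * \<eta> (2, i) / (\<rho> * sqrt (real n))"
proof -
  have "mat_diag n (\<lambda>i. \<eta> (1, i)) * V = Matrix.mat n n (\<lambda>(j, i). \<eta> (1, j) * V $$ (j, i))"
    using assms by (simp add: mat_diag_mult_left)
  then show ?thesis
    using assms by (simp add: R1_def mat_diag_mult_right[where nr = n and n = n])
qed

lemma R2_index:
  assumes "j < n" "i < n"
  shows "R2 n K L (\<eta>, J, X) $$ (j, i) = (if L < row_count n J j \<or> j \<notin> J i then 0
    else \<Sum>l<K. if j = sorted_list_of_set (J i) ! l then X (l, i) / real L else 0)"
proof -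
  have "{k. k < n \<and> row (H_bar n J) j $ k \<noteq> 0} = {k. k < n \<and> j \<in> J k}"
    using assms by (auto simp: H_bar_def split: if_splits)
  then have "num_nonzero (row (H_bar n J) j) = row_count n J j"
    by (simp add: num_nonzero_def row_count_def H_bar_def)
  then show ?thesis
    using assms by (simp add: R2_def hadamard_prod_def H_trunc_def R2_bar_def H_bar_def)
qed

lemma R2_index_nth:
  assumes "i < n" "J i \<subseteq> {..<n}" "card (J i) = K" "l < K"
  defines "j \<equiv> sorted_list_of_set (J i) ! l"
  shows "R2 n K L (\<eta>, J, X) $$ (j, i) = (if L < row_count n J j then 0 else X (l, i) / real L)"
proof -
  let ?s = "sorted_list_of_set (J i)"
  have len: "length ?s = K" and fin: "finite (J i)"
    using assms finite_subset[OF assms(2)] by auto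
  have j: "j \<in> J i" using nth_mem[of l ?s] len fin assms by simp
  have "(\<Sum>l'<K. if j = ?s ! l' then X (l', i) / real L else 0)
      = (\<Sum>l'<K. if l' = l then X (l', i) / real L else 0)"
    using assms(4) len by (intro sum.cong refl) (auto simp: j_def nth_eq_iff_index_eq)
  also have "\<dots> = X (l, i) / real L" using assms(4) by simp
  finally show ?thesis using j assms(1,2) by (auto simp: R2_index)
qed

lemma sum_R2_col:
  assumes "i < n" "J i \<subseteq> {..<n}" "card (J i) = K"
  shows "(\<Sum>j<n. R2 n K L (\<eta>, J, X) $$ (j, i) * u j) = (\<Sum>l<K.
    (let j = sorted_list_of_set (J i) ! l in if L < row_count n J j then 0 else u j / real L) *
      X (l, i))"
proof -
  let ?s = "\<lambda>l. sorted_list_of_set (J i) ! l"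
  have fin: "finite (J i)" using assms(2) finite_subset by blast
  have "(\<Sum>j<n. R2 n K L (\<eta>, J, X) $$ (j, i) * u j) = (\<Sum>j\<in>J i. R2 n K L (\<eta>, J, X) $$ (j, i) * u j)"
    using assms by (intro sum.mono_neutral_right) (auto simp: R2_index)
  also have "\<dots> = (\<Sum>l<K. R2 n K L (\<eta>, J, X) $$ (?s l, i) * u (?s l))"
    using sum.reindex_bij_betw[OF bij_betw_nth_sorted_list_of_set[OF fin],
        of "\<lambda>j. R2 n K L (\<eta>, J, X) $$ (j, i) * u j"] assms(3) by simp
  also have "\<dots> = (\<Sum>l<K.
      (let j = ?s l in if L < row_count n J j then 0 else u j / real L) * X (l, i))"
    using assms by (intro sum.cong refl) (auto simp: R2_index_nth Let_def)
  finally show ?thesis .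
qed

lemma smult_mat_mult_vec:
  fixes c :: real
  assumes "B \<in> carrier_mat m n" "x \<in> carrier_vec n"
  shows "(c \<cdot>\<^sub>m B) *\<^sub>v x = c \<cdot>\<^sub>v (B *\<^sub>v x)"
  using assms by (intro eq_vecI) auto

lemma l2_norm_R1_mult_le:
  assumes V: "V \<in> carrier_mat n n" "spectral_norm V \<le> \<rho> * sqrt (real n)" and x: "x \<in> carrier_vec n"
    and signs: "\<And>k i. k \<in> {1, 2} \<Longrightarrow> i < n \<Longrightarrow> \<eta> (k, i) \<in> {-1, 1}" and "0 < \<rho>" "0 < n"
  shows "l2_norm (R1 n \<rho> V (\<eta>, J, X) *\<^sub>v x) \<le> l2_norm x"
proof -
  let ?D = "\<lambda>k. mat_diag n (\<lambda>i. \<eta> (k, i))"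
  have isometry: "l2_norm (?D k *\<^sub>v y) = l2_norm y" if "k \<in> {1, 2}" "y \<in> carrier_vec n" for k y
    using signs[OF that(1)] by (intro l2_norm_mat_diag_mult that(2)) fastforce
  have D: "?D k \<in> carrier_mat n n" for k by simp
  have D1V: "?D 1 * V \<in> carrier_mat n n" using D V(1) by (rule mult_carrier_mat)
  have D2x: "?D 2 *\<^sub>v x \<in> carrier_vec n" using D x by (rule mult_mat_vec_carrier)
  then have VD2x: "V *\<^sub>v (?D 2 *\<^sub>v x) \<in> carrier_vec n" using V(1) by simp
  have "R1 n \<rho> V (\<eta>, J, X) *\<^sub>v x = (1 / (\<rho> * sqrt (real n))) \<cdot>\<^sub>v (?D 1 *\<^sub>v (V *\<^sub>v (?D 2 *\<^sub>v x)))"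
    unfolding R1_def prod.case smult_mat_mult_vec[OF mult_carrier_mat[OF D1V D] x]
      assoc_mult_mat_vec[OF D1V D x] assoc_mult_mat_vec[OF D V(1) D2x] by (rule refl)
  then have "l2_norm (R1 n \<rho> V (\<eta>, J, X) *\<^sub>v x)
      = 1 / (\<rho> * sqrt (real n)) * l2_norm (V *\<^sub>v (?D 2 *\<^sub>v x))"
    using \<open>0 < \<rho>\<close> isometry[OF _ VD2x, of 1] by (simp add: l2_norm_smult)
  also have "\<dots> \<le> 1 / (\<rho> * sqrt (real n)) * (\<rho> * sqrt (real n) * l2_norm (?D 2 *\<^sub>v x))"
    using \<open>0 < \<rho>\<close>
    by (intro mult_left_mono order_trans[OF l2_norm_mult_mat_vec_le[OF V(1) D2x]]
        mult_right_mono V(2)) auto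
  also have "\<dots> = l2_norm x" using \<open>0 < \<rho>\<close> \<open>0 < n\<close> isometry[OF _ x, of 2] by simp
  finally show ?thesis .
qed

lemma abs_R2_le:
  assumes "j < n" "i < n" "J i \<subseteq> {..<n}" "card (J i) = K" and X: "\<And>l. l < K \<Longrightarrow> X (l, i) \<in> {-1, 1}"
  shows "\<bar>R2 n K L (\<eta>, J, X) $$ (j, i)\<bar> \<le> 1 / real L"
proof (cases "j \<in> J i")
  case True
  have "finite (J i)" using assms(3) finite_subset by blast
  then obtain l where "l < K" "j = sorted_list_of_set (J i) ! l"
    using True bij_betw_nth_sorted_list_of_set[of "J i"] assms(4) by (auto simp: bij_betw_def)
  then show ?thesis using X[of l] assms(2-4) by (auto simp: R2_index_nth)
qed (use assms(1,2) in \<open>simp add: R2_index\<close>)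

lemma card_R2_row_le:
  assumes "j < n"
  shows "card {i. i < n \<and> R2 n K L (\<eta>, J, X) $$ (j, i) \<noteq> 0} \<le> L"
proof (cases "row_count n J j \<le> L")
  case True
  have "card {i. i < n \<and> R2 n K L (\<eta>, J, X) $$ (j, i) \<noteq> 0} \<le> row_count n J j"
    unfolding row_count_def using assms
    by (intro card_mono) (auto simp: R2_index split: if_splits)
  then show ?thesis using True by simp
next
  case False
  then have "{i. i < n \<and> R2 n K L (\<eta>, J, X) $$ (j, i) \<noteq> 0} = {}"
    using assms by (auto simp: R2_index)
  then show ?thesis by (simp only: card.empty)
qed

lemma card_R2_col_le:
  assumes "i < n" "finite (J i)"
  shows "card {j. j < n \<and> R2 n K L (\<eta>, J, X) $$ (j, i) \<noteq> 0} \<le> card (J i)"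
  using assms by (intro card_mono) (auto simp: R2_index split: if_splits)

lemma l2_norm_R2_mult_le:
  assumes x: "x \<in> carrier_vec n" and J: "\<And>i. i < n \<Longrightarrow> J i \<subseteq> {..<n} \<and> card (J i) = K"
    and X: "\<And>l i. l < K \<Longrightarrow> i < n \<Longrightarrow> X (l, i) \<in> {-1, 1}" and "K \<le> L"
  shows "l2_norm (R2 n K L (\<eta>, J, X) *\<^sub>v x) \<le> l2_norm x"
proof -
  have "l2_norm (R2 n K L (\<eta>, J, X) *\<^sub>v x) \<le> 1 / real L * sqrt (real K * real L) * l2_norm x"
  proof (rule l2_norm_sparse_mult_le[OF R2_carrier x])
    show "\<bar>R2 n K L (\<eta>, J, X) $$ (j, i)\<bar> \<le> 1 / real L" if "j < n" "i < n" for j i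
      using that J X by (intro abs_R2_le) auto
    show "card {j. j < n \<and> R2 n K L (\<eta>, J, X) $$ (j, i) \<noteq> 0} \<le> K" if "i < n" for i
      using card_R2_col_le[of i n J] that J[OF that] finite_subset[of "J i" "{..<n}"] by simp
  qed (simp_all add: card_R2_row_le)
  also have "\<dots> \<le> 1 * l2_norm x"
  proof (rule mult_right_mono)
    have "sqrt (real K * real L) \<le> real L"
      using \<open>K \<le> L\<close> by (intro real_le_lsqrt) (auto simp: power2_eq_square mult_right_mono)
    then show "1 / real L * sqrt (real K * real L) \<le> 1"
      by (cases "L = 0") (simp_all add: field_simps)
  qed simp
  finally show ?thesis by simp
qed

lemma perturbation_law_eq: "perturbation_law n K = pair_pmf (rademacher_signs ({1, 2} \<times> {..<n}))
    (pair_pmf (random_subsets n K) (rademacher_signs ({..<K} \<times> {..<n})))"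
  by (simp add: perturbation_law_def random_subsets_def card_subsets_def)

lemma set_pmf_perturbation_law:
  assumes "(\<eta>, J, X) \<in> set_pmf (perturbation_law n K)" "K \<le> n"
  shows "\<And>k i. k \<in> {1, 2} \<Longrightarrow> i < n \<Longrightarrow> \<eta> (k, i) \<in> {-1, 1}"
    and "\<And>i. i < n \<Longrightarrow> J i \<subseteq> {..<n} \<and> card (J i) = K"
    and "\<And>l i. l < K \<Longrightarrow> i < n \<Longrightarrow> X (l, i) \<in> {-1, 1}"
proof -
  have \<eta>: "\<eta> \<in> set_pmf (rademacher_signs ({1, 2} \<times> {..<n}))"
    and J: "J \<in> set_pmf (random_subsets n K)"
    and X: "X \<in> set_pmf (rademacher_signs ({..<K} \<times> {..<n}))"
    using assms(1) by (auto simp: perturbation_law_eq)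
  show "\<eta> (k, i) \<in> {-1, 1}" if "k \<in> {1, 2}" "i < n" for k i
    using \<eta> that by (auto simp: set_Pi_pmf PiE_dflt_def)
  show "J i \<subseteq> {..<n} \<and> card (J i) = K" if "i < n" for i
    using set_pmf_random_subsets[OF assms(2) J that] by simp
  show "X (l, i) \<in> {-1, 1}" if "l < K" "i < n" for l i
    using X that by (auto simp: set_Pi_pmf PiE_dflt_def)
qed

lemma row_count_empty:
  assumes "i < n"
  shows "row_count n J j = row_count n (J(i := {})) j + of_bool (j \<in> J i)"
proof (cases "j \<in> J i")
  case True
  then have "{i'. i' < n \<and> j \<in> J i'} = insert i {i'. i' < n \<and> j \<in> (J(i := {})) i'}"
    using assms by auto
  then show ?thesis using True by (simp add: row_count_def)
next
  case False
  then have "{i'. i' < n \<and> j \<in> J i'} = {i'. i' < n \<and> j \<in> (J(i := {})) i'}" by auto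
  then show ?thesis using False by (simp add: row_count_def)
qed

lemma card_heavy_rows_le:
  assumes "1 \<le> L"
  shows "real (card (heavy_rows n L J)) \<le> (\<Sum>j\<in>heavy_rows n L J. real (row_count n J j))"
proof -
  have "real (card (heavy_rows n L J)) = (\<Sum>j\<in>heavy_rows n L J. 1)" by simp
  also have "\<dots> \<le> (\<Sum>j\<in>heavy_rows n L J. real (row_count n J j))"
    using assms by (intro sum_mono) (auto simp: heavy_rows_def)
  finally show ?thesis .
qed

lemma card_columns_meeting_heavy_rows_le:
  assumes "\<And>i. i < n \<Longrightarrow> J i \<subseteq> {..<n}"
  shows "real (card {i. i < n \<and> (\<exists>j\<in>J i. L < row_count n J j)})
    \<le> (\<Sum>j\<in>heavy_rows n L J. real (row_count n J j))"
proof -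
  have fin: "finite (heavy_rows n L J)" by (simp add: heavy_rows_def)
  have "{i. i < n \<and> (\<exists>j\<in>J i. L < row_count n J j)} \<subseteq> (\<Union>j\<in>heavy_rows n L J. {i. i < n \<and> j \<in> J i})"
    using assms by (fastforce simp: heavy_rows_def)
  then have "card {i. i < n \<and> (\<exists>j\<in>J i. L < row_count n J j)}
      \<le> card (\<Union>j\<in>heavy_rows n L J. {i. i < n \<and> j \<in> J i})"
    using fin by (intro card_mono) auto
  also have "\<dots> \<le> (\<Sum>j\<in>heavy_rows n L J. row_count n J j)"
    unfolding row_count_def by (rule card_UN_le[OF fin])
  finally show ?thesis by (simp flip: of_nat_sum)
qed

lemma card_singleton_Times_filter:
  "card {p \<in> {k} \<times> {..<n}. P p} = card {i. i < (n :: nat) \<and> P (k, i)}"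
  by (rule bij_betw_same_card[of snd], rule bij_betw_byWitness[where f' = "Pair k"]) auto

subsection \<open>Anticoncentration along column normals\<close>

locale perturbation_model =
  fixes n K L :: nat and A V :: "real Matrix.mat" and \<rho> \<epsilon> \<alpha> \<beta> \<gamma> \<nu> :: real
  assumes K_pos: "1 \<le> K" and K_le_n: "K \<le> n" and K_le_L: "K \<le> L"
    and A_carrier: "A \<in> carrier_mat n n" and A_norm: "spectral_norm A \<le> 1"
    and V_pattern: "pattern_matrix n \<alpha> \<beta> \<gamma> \<rho> V"
    and \<rho>_pos: "0 < \<rho>" and \<epsilon>_pos: "0 < \<epsilon>" and \<epsilon>_le: "\<epsilon> \<le> 1"
    and \<alpha>_pos: "0 < \<alpha>" and \<beta>_pos: "0 < \<beta>" and \<gamma>_n: "16 \<le> \<gamma> * real n"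
    and \<nu>_pos: "0 < \<nu>" and \<nu>_less: "\<nu> < 2" and \<nu>_small: "144 * \<nu>\<^sup>2 * \<rho>\<^sup>2 < \<epsilon>\<^sup>2 * \<beta>\<^sup>2 * \<gamma>"
begin

definition M :: "perturbation_input \<Rightarrow> real Matrix.mat" where
  "M \<omega> = A + \<epsilon> \<cdot>\<^sub>m (R1 n \<rho> V \<omega> + R2 n K L \<omega>)"

definition threshold :: real where
  "threshold = \<nu> / (2 * sqrt (real n))"

text \<open>Emptying \<open>J i\<close> makes the normal vector independent of the \<open>i\<close>-th column, including its
  effect on the truncation of the other columns.\<close>

definition detach :: "nat \<Rightarrow> perturbation_input \<Rightarrow> perturbation_input" where
  "detach i = (\<lambda>(\<eta>, J, X). (\<eta>, J(i := {}), X))"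

definition normal :: "nat \<Rightarrow> perturbation_input \<Rightarrow> real Matrix.vec" where
  "normal i \<omega> = (SOME u. column_normal (M (detach i \<omega>)) i u)"

definition light_support :: "nat \<Rightarrow> perturbation_input \<Rightarrow> nat set" where
  "light_support i = (\<lambda>(\<eta>, J, X). {j. j < n \<and> row_count n (J(i := {})) j < L \<and>
    threshold \<le> \<bar>normal i (\<eta>, J, X) $ j\<bar>})"

definition small_column :: "nat \<Rightarrow> perturbation_input \<Rightarrow> bool" where
  "small_column i \<omega> \<longleftrightarrow> \<alpha> * real n / 2 \<le> real (card (light_support i \<omega>)) \<and>
    \<bar>col (M \<omega>) i \<bullet> normal i \<omega>\<bar> < \<epsilon> * threshold / real L"

lemma n_pos: "0 < n"
  using K_pos K_le_n by simp

lemma L_pos: "0 < L"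
  using K_pos K_le_L by simp

lemma V_carrier: "V \<in> carrier_mat n n"
  using V_pattern by (simp add: pattern_matrix_def)

lemma threshold_pos: "0 < threshold"
  using \<nu>_pos n_pos by (simp add: threshold_def)

lemma M_carrier [simp]: "M \<omega> \<in> carrier_mat n n"
  using A_carrier by (simp add: M_def)

lemma M_dim [simp]: "dim_row (M \<omega>) = n" "dim_col (M \<omega>) = n"
  using carrier_matD[OF M_carrier[of \<omega>]] by simp_all

lemma M_index:
  assumes "j < n" "i < n"
  shows "M (\<eta>, J, X) $$ (j, i) = A $$ (j, i) +
    \<epsilon> * (\<eta> (1, j) * V $$ (j, i) * \<eta> (2, i) / (\<rho> * sqrt (real n)) + R2 n K L (\<eta>, J, X) $$ (j, i))"
  using assms A_carrier carrier_matD[OF R1_carrier[of n \<rho> V "(\<eta>, J, X)"]]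
    carrier_matD[OF R2_carrier[of n K L "(\<eta>, J, X)"]]
  by (simp add: M_def R1_index[OF V_carrier])

lemma l2_norm_M_mult_le:
  assumes "\<omega> \<in> set_pmf (perturbation_law n K)" and x: "x \<in> carrier_vec n"
  shows "l2_norm (M \<omega> *\<^sub>v x) \<le> 3 * l2_norm x"
proof -
  obtain \<eta> J X where \<omega>: "\<omega> = (\<eta>, J, X)" by (cases \<omega>) auto
  note law = set_pmf_perturbation_law[OF assms(1)[unfolded \<omega>] K_le_n]
  have R1x: "R1 n \<rho> V \<omega> *\<^sub>v x \<in> carrier_vec n" and R2x: "R2 n K L \<omega> *\<^sub>v x \<in> carrier_vec n"
    and Ax: "A *\<^sub>v x \<in> carrier_vec n"
    by (rule mult_mat_vec_carrier[OF R1_carrier x] mult_mat_vec_carrier[OF R2_carrier x]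
        mult_mat_vec_carrier[OF A_carrier x])+
  have "M \<omega> *\<^sub>v x = A *\<^sub>v x + \<epsilon> \<cdot>\<^sub>v (R1 n \<rho> V \<omega> *\<^sub>v x + R2 n K L \<omega> *\<^sub>v x)"
    using A_carrier x
    by (simp add: M_def add_mult_distrib_mat_vec[of _ n n] smult_mat_mult_vec[of _ n n])
  then have "l2_norm (M \<omega> *\<^sub>v x)
      \<le> l2_norm (A *\<^sub>v x) + \<epsilon> * l2_norm (R1 n \<rho> V \<omega> *\<^sub>v x + R2 n K L \<omega> *\<^sub>v x)"
    using l2_norm_add_le[OF Ax, of "\<epsilon> \<cdot>\<^sub>v (R1 n \<rho> V \<omega> *\<^sub>v x + R2 n K L \<omega> *\<^sub>v x)"] R1x R2x \<epsilon>_pos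
    by (simp add: l2_norm_smult)
  also have "\<dots> \<le> l2_norm x + 1 * (l2_norm x + l2_norm x)"
  proof (intro add_mono mult_mono \<epsilon>_le order_trans[OF l2_norm_add_le[OF R1x R2x]])
    show "l2_norm (A *\<^sub>v x) \<le> l2_norm x"
      using l2_norm_mult_mat_vec_le[OF A_carrier x] mult_right_mono[OF A_norm, of "l2_norm x"]
      by simp
    show "l2_norm (R1 n \<rho> V \<omega> *\<^sub>v x) \<le> l2_norm x"
      unfolding \<omega> using V_pattern
      by (intro l2_norm_R1_mult_le V_carrier x law(1) \<rho>_pos n_pos) (simp add: pattern_matrix_def)
    show "l2_norm (R2 n K L \<omega> *\<^sub>v x) \<le> l2_norm x"
      unfolding \<omega> using K_le_L by (intro l2_norm_R2_mult_le x law(2,3))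
  qed simp_all
  finally show ?thesis by simp
qed

lemma column_normal_normal:
  assumes "i < n" and untruncated: "\<And>j. j \<in> J i \<Longrightarrow> row_count n J j \<le> L"
  shows "column_normal (M (\<eta>, J, X)) i (normal i (\<eta>, J, X))"
proof -
  have detached: "column_normal (M (detach i (\<eta>, J, X))) i (normal i (\<eta>, J, X))"
    unfolding normal_def by (rule someI_ex[OF ex_column_normal[OF M_carrier \<open>i < n\<close>]])
  have "col (M (detach i (\<eta>, J, X))) i' = col (M (\<eta>, J, X)) i'" if "i' < n" "i' \<noteq> i" for i'
  proof (rule eq_vecI)
    fix j assume "j < dim_vec (col (M (\<eta>, J, X)) i')"
    then have j: "j < n" by simp
    have "L < row_count n (J(i := {})) j \<longleftrightarrow> L < row_count n J j"
      using untruncated[of j] row_count_empty[OF \<open>i < n\<close>, of J j] by (cases "j \<in> J i") auto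
    then have "R2 n K L (\<eta>, J(i := {}), X) $$ (j, i') = R2 n K L (\<eta>, J, X) $$ (j, i')"
      using j that by (simp add: R2_index)
    then show "col (M (detach i (\<eta>, J, X))) i' $ j = col (M (\<eta>, J, X)) i' $ j"
      using j that by (simp add: detach_def M_index)
  qed simp
  then show ?thesis using detached by (simp add: column_normal_def)
qed

lemma normal_carrier:
  assumes "i < n"
  shows "normal i \<omega> \<in> carrier_vec n"
  using someI_ex[OF ex_column_normal[OF M_carrier[of "detach i \<omega>"] assms]]
  by (simp add: normal_def column_normal_def unit_sphere_def)

definition resample ::
    "nat \<Rightarrow> perturbation_input \<Rightarrow> nat set \<Rightarrow> (nat \<times> nat \<Rightarrow> real) \<Rightarrow> perturbation_input" where
  "resample i = (\<lambda>(\<eta>, J, X) S Y. (\<eta>, J(i := S), override_on X Y ({..<K} \<times> {i})))"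

lemma normal_resample: "normal i (resample i \<omega> S Y) = normal i \<omega>"
proof -
  obtain \<eta> J X where \<omega>: "\<omega> = (\<eta>, J, X)" by (cases \<omega>) auto
  have "R2 n K L (detach i (resample i \<omega> S Y)) = R2 n K L (detach i \<omega>)"
    by (rule eq_matI)
      (auto simp: \<omega> detach_def resample_def R2_index carrier_matD[OF R2_carrier] intro!: sum.cong)
  moreover have "R1 n \<rho> V (detach i (resample i \<omega> S Y)) = R1 n \<rho> V (detach i \<omega>)"
    by (simp add: \<omega> detach_def resample_def R1_def)
  ultimately show ?thesis by (simp add: normal_def M_def)
qed

lemma light_support_resample: "light_support i (resample i \<omega> S Y) = light_support i \<omega>"
  using normal_resample[of i \<omega> S Y] by (cases \<omega>) (simp add: light_support_def resample_def)

definition offset :: "nat \<Rightarrow> perturbation_input \<Rightarrow> real" where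
  "offset i = (\<lambda>(\<eta>, J, X). \<Sum>j<n.
    (A $$ (j, i) + \<epsilon> * (\<eta> (1, j) * V $$ (j, i) * \<eta> (2, i) / (\<rho> * sqrt (real n)))) *
      normal i (\<eta>, J, X) $ j)"

definition weight :: "nat \<Rightarrow> perturbation_input \<Rightarrow> nat \<Rightarrow> real" where
  "weight i = (\<lambda>(\<eta>, J, X) j.
    if row_count n (J(i := {})) j < L then \<epsilon> * normal i (\<eta>, J, X) $ j / real L else 0)"

lemma large_weight_eq_light_support:
  "{j. j < n \<and> \<epsilon> * threshold / real L \<le> \<bar>weight i \<omega> j\<bar>} = light_support i \<omega>"
proof -
  obtain \<eta> J X where \<omega>: "\<omega> = (\<eta>, J, X)" by (cases \<omega>) auto
  have "\<epsilon> * threshold / real L \<le> \<bar>\<epsilon> * y / real L\<bar> \<longleftrightarrow> threshold \<le> \<bar>y\<bar>" for y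
    using \<epsilon>_pos L_pos by (simp add: abs_mult divide_le_cancel)
  moreover have "\<not> \<epsilon> * threshold / real L \<le> 0"
    using \<epsilon>_pos L_pos threshold_pos by (simp add: not_le)
  ultimately show ?thesis by (auto simp: \<omega> weight_def light_support_def)
qed

lemma col_resample_scalar_prod:
  assumes "i < n" and S: "S \<subseteq> {..<n}" "card S = K"
  shows "col (M (resample i \<omega> S Y)) i \<bullet> normal i \<omega> = offset i \<omega> +
    (\<Sum>p\<in>{..<K} \<times> {i}. weight i \<omega> (sorted_list_of_set S ! fst p) * Y p)"
proof -
  obtain \<eta> J X where \<omega>: "\<omega> = (\<eta>, J, X)" by (cases \<omega>) auto
  define u where "u = normal i \<omega>"
  define J' where "J' = J(i := S)"
  define X' where "X' = override_on X Y ({..<K} \<times> {i})"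
  let ?s = "\<lambda>l. sorted_list_of_set S ! l"
  have s: "?s l \<in> S" if "l < K" for l
    using that S finite_subset[OF S(1)] nth_mem[of l "sorted_list_of_set S"] by simp
  have "col (M (\<eta>, J', X')) i \<bullet> u = (\<Sum>j<n. M (\<eta>, J', X') $$ (j, i) * u $ j)"
    using \<open>i < n\<close> normal_carrier[OF \<open>i < n\<close>]
    by (intro col_scalar_prod_sum[OF M_carrier]) (auto simp: u_def)
  also have "\<dots> = offset i \<omega> + \<epsilon> * (\<Sum>j<n. R2 n K L (\<eta>, J', X') $$ (j, i) * u $ j)"
    using \<open>i < n\<close>
    by (simp add: offset_def \<omega> u_def M_index distrib_left distrib_right sum.distrib
        sum_distrib_left mult_ac)
  also have "(\<Sum>j<n. R2 n K L (\<eta>, J', X') $$ (j, i) * u $ j)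
      = (\<Sum>l<K. (let j = ?s l in if L < row_count n J' j then 0 else u $ j / real L) * X' (l, i))"
    using sum_R2_col[OF \<open>i < n\<close>, of J'] S by (simp add: J'_def)
  also have "\<epsilon> * \<dots> = (\<Sum>l<K. weight i \<omega> (?s l) * Y (l, i))"
    unfolding sum_distrib_left
  proof (rule sum.cong[OF refl])
    fix l assume "l \<in> {..<K}"
    then have "L < row_count n J' (?s l) \<longleftrightarrow> \<not> row_count n (J(i := {})) (?s l) < L"
      "X' (l, i) = Y (l, i)"
      using s[of l] row_count_empty[OF \<open>i < n\<close>, of J' "?s l"] by (auto simp: J'_def X'_def)
    then show "\<epsilon> * ((let j = ?s l in if L < row_count n J' j then 0 else u $ j / real L) *
          X' (l, i))
        = weight i \<omega> (?s l) * Y (l, i)"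
      by (simp add: weight_def \<omega> u_def)
  qed
  also have "\<dots> = (\<Sum>p\<in>{..<K} \<times> {i}. weight i \<omega> (?s (fst p)) * Y p)"
    by (rule sum.reindex_bij_witness[of _ fst "\<lambda>l. (l, i)"]) auto
  finally show ?thesis by (simp add: \<omega> resample_def J'_def X'_def u_def del: fun_upd_apply)
qed

lemma small_column_resample_iff:
  assumes "i < n" "S \<in> card_subsets n K"
  shows "small_column i (resample i \<omega> S Y) \<longleftrightarrow> \<alpha> * real n / 2 \<le> real (card (light_support i \<omega>)) \<and>
    \<bar>offset i \<omega> + (\<Sum>p\<in>{..<K} \<times> {i}. weight i \<omega> (sorted_list_of_set S ! fst p) * Y p)\<bar>
      < \<epsilon> * threshold / real L"
  using col_resample_scalar_prod[OF assms(1), of S \<omega> Y] assms(2)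
  by (simp add: small_column_def normal_resample light_support_resample card_subsets_def)

lemma prob_small_column_resample_le:
  assumes "i < n"
  shows "measure_pmf.prob
      (pair_pmf (pmf_of_set (card_subsets n K)) (rademacher_signs ({..<K} \<times> {i})))
      {(S, Y). small_column i (resample i \<omega> S Y)} \<le> 8 / (\<alpha> * real K) + 2 / sqrt (\<alpha> * real K)"
    (is "measure_pmf.prob ?P _ \<le> ?bound")
proof (cases "\<alpha> * real n / 2 \<le> real (card (light_support i \<omega>))")
  case True
  define \<mu> where "\<mu> = \<alpha> * real K / 2"
  define r where "r = \<epsilon> * threshold / real L"
  have "measure_pmf.prob ?P {(S, Y). small_column i (resample i \<omega> S Y)}
      = measure_pmf.prob ?P ({(S, Y). small_column i (resample i \<omega> S Y)} \<inter> set_pmf ?P)"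
    by (rule measure_Int_set_pmf[symmetric])
  also have "\<dots> \<le> measure_pmf.prob ?P {(S, Y).
      \<bar>offset i \<omega> + (\<Sum>p\<in>{..<K} \<times> {i}. weight i \<omega> (sorted_list_of_set S ! fst p) * Y p)\<bar> < r}"
    by (intro measure_pmf.finite_measure_mono)
      (auto simp: r_def set_pmf_of_card_subsets[OF K_le_n] small_column_resample_iff[OF assms])
  also have "\<dots> \<le> 4 / \<mu> + sqrt (2 / \<mu>)"
  proof (rule littlewood_offord_random_support[OF K_pos K_le_n])
    show "bij_betw fst ({..<K} \<times> {i}) {..<K}"
      by (rule bij_betw_byWitness[where f' = "\<lambda>l. (l, i)"]) auto
    show "0 < r" using \<epsilon>_pos threshold_pos L_pos by (simp add: r_def)
    show "0 < \<mu>" using \<alpha>_pos K_pos by (simp add: \<mu>_def)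
    show "\<mu> \<le> real K * real (card {j. j < n \<and> r \<le> \<bar>weight i \<omega> j\<bar>}) / real n"
      using mult_left_mono[OF True, of "real K"] n_pos
      by (simp add: r_def large_weight_eq_light_support \<mu>_def field_simps)
  qed
  also have "\<dots> = ?bound" by (simp add: \<mu>_def real_sqrt_divide)
  finally show ?thesis .
next
  case False
  then have "{(S, Y). small_column i (resample i \<omega> S Y)} = {}"
    by (auto simp: small_column_def light_support_resample)
  then show ?thesis using \<alpha>_pos by (simp only: measure_empty) simp
qed

lemma prob_small_column_le:
  assumes "i < n"
  shows "measure_pmf.prob (perturbation_law n K) {\<omega>. small_column i \<omega>}
    \<le> 8 / (\<alpha> * real K) + 2 / sqrt (\<alpha> * real K)"
  unfolding perturbation_law_eq random_subsets_def
proof (rule prob_pair_pmf_le_fst,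
    rule prob_pair_Pi_pmf_override_le[where A' = "{i}" and B' = "{..<K} \<times> {i}"], goal_cases)
  case (5 \<eta> J X)
  have "override_on J J' {i} = J(i := J' i)" for J' by (simp add: override_on_insert)
  then show ?case
    using prob_small_column_resample_le[OF assms, of "(\<eta>, J, X)"]
    by (simp add: Pi_pmf_singleton pair_map_pmf1 vimage_def case_prod_unfold resample_def)
qed (use assms \<alpha>_pos in auto)

subsection \<open>Spreading of sparse vectors\<close>

definition spread_threshold :: real where
  "spread_threshold = \<epsilon> * \<beta> / (\<rho> * sqrt (real n))"

definition fixed_coeff :: "perturbation_input \<Rightarrow> nat \<times> nat \<Rightarrow> nat \<Rightarrow> real" where
  "fixed_coeff \<omega> = (\<lambda>(k, i) j. A $$ (j, i) + \<epsilon> * R2 n K L \<omega> $$ (j, i))"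

definition signed_coeff :: "perturbation_input \<Rightarrow> nat \<times> nat \<Rightarrow> nat \<Rightarrow> real" where
  "signed_coeff \<omega> = (\<lambda>(k, i) j. \<epsilon> / (\<rho> * sqrt (real n)) * (V $$ (j, i) * fst \<omega> (1, j)))"

lemma col_M_scalar_prod:
  assumes "i < n" "u \<in> carrier_vec n"
  shows "col (M \<omega>) i \<bullet> u = (\<Sum>j<n. fixed_coeff \<omega> (2, i) j * u $ j)
    + fst \<omega> (2, i) * (\<Sum>j<n. signed_coeff \<omega> (2, i) j * u $ j)"
proof -
  obtain \<eta> J X where \<omega>: "\<omega> = (\<eta>, J, X)" by (cases \<omega>) auto
  have "col (M \<omega>) i \<bullet> u = (\<Sum>j<n. M \<omega> $$ (j, i) * u $ j)"
    by (rule col_scalar_prod_sum[OF M_carrier assms])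
  also have "\<dots> = (\<Sum>j<n. fixed_coeff \<omega> (2, i) j * u $ j
      + fst \<omega> (2, i) * (signed_coeff \<omega> (2, i) j * u $ j))"
    using assms(1)
    by (intro sum.cong refl) (simp add: \<omega> M_index fixed_coeff_def signed_coeff_def algebra_simps)
  finally show ?thesis by (simp add: sum.distrib sum_distrib_left)
qed

lemma card_large_signed_coeff_sum_ge:
  assumes \<eta>: "\<And>j. j < n \<Longrightarrow> fst \<omega> (1, j) \<in> {-1, 1}"
    and u: "u \<in> unit_sphere n" "real (num_nonzero u) \<le> \<alpha> * real n"
  shows "\<gamma> * real n \<le> real (card {p \<in> {2} \<times> {..<n}.
    spread_threshold \<le> \<bar>\<Sum>j<n. signed_coeff \<omega> p j * u $ j\<bar>})"
proof -
  define \<eta>1 where "\<eta>1 j = fst \<omega> (1, j)" for j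
  define c where "c = \<epsilon> / (\<rho> * sqrt (real n))"
  have c: "0 < c" using \<epsilon>_pos \<rho>_pos n_pos by (simp add: c_def)
  have "(\<Sum>j<n. signed_coeff \<omega> (2, i) j * u $ j) = c * (V\<^sup>T * mat_diag n \<eta>1 *\<^sub>v u) $ i"
    if "i < n" for i
  proof -
    have "V\<^sup>T * mat_diag n \<eta>1 = Matrix.mat n n (\<lambda>(i, j). V $$ (j, i) * \<eta>1 j)"
      using V_carrier by (subst mat_diag_mult_right[where n = n]) (auto intro!: eq_matI)
    then show ?thesis
      using that u(1)
      by (auto simp: unit_sphere_def scalar_prod_def lessThan_atLeast0 signed_coeff_def c_def \<eta>1_def
          sum_distrib_left mult.assoc)
  qed
  moreover have "spread_threshold = c * \<beta>" by (simp add: spread_threshold_def c_def)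
  ultimately have "spread_threshold \<le> \<bar>\<Sum>j<n. signed_coeff \<omega> (2, i) j * u $ j\<bar>
      \<longleftrightarrow> \<beta> \<le> \<bar>(V\<^sup>T * mat_diag n \<eta>1 *\<^sub>v u) $ i\<bar>" if "i < n" for i
    using c that by (simp add: abs_mult)
  then have "{i. i < n \<and> spread_threshold \<le> \<bar>\<Sum>j<n. signed_coeff \<omega> (2, i) j * u $ j\<bar>}
      = {i. i < n \<and> \<beta> \<le> \<bar>(V\<^sup>T * mat_diag n \<eta>1 *\<^sub>v u) $ i\<bar>}" by blast
  moreover have "\<eta>1 \<in> {..<n} \<rightarrow> {-1, 1}" using \<eta> unfolding \<eta>1_def by blast
  ultimately show ?thesis
    unfolding card_singleton_Times_filter using V_pattern u by (simp add: pattern_matrix_def)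
qed

lemma not_spreads_sparse_eq_cancelling_signs:
  "{\<eta>. \<not> spreads_sparse (M (override_on h \<eta> ({2} \<times> {..<n}), J, X)) \<alpha> spread_threshold s}
    = (\<Union>u\<in>($) ` {u \<in> unit_sphere n. real (num_nonzero u) \<le> \<alpha> * real n}.
        cancelling_signs {..<n} ({2} \<times> {..<n}) (fixed_coeff (h, J, X)) (signed_coeff (h, J, X))
          spread_threshold s u)"
proof -
  have "col (M (override_on h \<eta> ({2} \<times> {..<n}), J, X)) i \<bullet> u
      = (\<Sum>j<n. fixed_coeff (h, J, X) (2, i) j * u $ j)
        + \<eta> (2, i) * (\<Sum>j<n. signed_coeff (h, J, X) (2, i) j * u $ j)"
    if "i < n" "u \<in> unit_sphere n" for \<eta> i u
    using that
    by (simp add: col_M_scalar_prod unit_sphere_def fixed_coeff_def signed_coeff_def R2_def)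
  then have card: "card {i. i < n \<and>
        spread_threshold \<le> \<bar>col (M (override_on h \<eta> ({2} \<times> {..<n}), J, X)) i \<bullet> u\<bar>}
      = card {i. i < n \<and> spread_threshold \<le> \<bar>(\<Sum>j<n. fixed_coeff (h, J, X) (2, i) j * u $ j)
          + \<eta> (2, i) * (\<Sum>j<n. signed_coeff (h, J, X) (2, i) j * u $ j)\<bar>}"
    if "u \<in> unit_sphere n" for \<eta> u
    using that by (intro arg_cong[of _ _ card]) auto
  show ?thesis
    unfolding spreads_sparse_def cancelling_signs_def card_singleton_Times_filter M_dim
    using card by (auto simp: not_le)
qed

lemma prob_not_spreads_sparse_given_le:
  fixes x :: real and h :: "nat \<times> nat \<Rightarrow> real"
  assumes x: "0 < x" "x \<le> 1" and m: "m = nat \<lfloor>\<alpha> * real n\<rfloor>"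
    and h: "\<And>j. j < n \<Longrightarrow> h (1, j) \<in> {-1, 1}"
  shows "measure_pmf.prob (rademacher_signs ({2} \<times> {..<n}))
      {\<eta>. \<not> spreads_sparse (M (override_on h \<eta> ({2} \<times> {..<n}), J, X)) \<alpha>
        spread_threshold (\<gamma> * real n / 8)}
    \<le> (1 + x) ^ (4 * n) / x ^ (2 * m + 1) * exp (- (\<gamma> * real n) / 4)"
proof -
  let ?B = "{2 :: nat} \<times> {..<n}" and ?\<omega> = "(h, J, X)"
  have "measure_pmf.prob (rademacher_signs ?B)
      (\<Union>u\<in>($) ` {u \<in> unit_sphere n. real (num_nonzero u) \<le> \<alpha> * real n}.
        cancelling_signs {..<n} ?B (fixed_coeff ?\<omega>) (signed_coeff ?\<omega>)
          spread_threshold (\<gamma> * real n / 8) u)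
    \<le> (1 + x) ^ (card {..<n} + 3 * card ?B) / x ^ (2 * m + 1) * exp (- (\<gamma> * real n) / 4)"
  proof (intro prob_cancelling_signs_sparse_le x)
    fix u' assume "u' \<in> ($) ` {u \<in> unit_sphere n. real (num_nonzero u) \<le> \<alpha> * real n}"
    then obtain u where u: "u \<in> unit_sphere n" "real (num_nonzero u) \<le> \<alpha> * real n" "u' = ($) u"
      by auto
    then show "card {j \<in> {..<n}. u' j \<noteq> 0} \<le> m"
      using le_nat_floor[OF u(2)] by (auto simp: unit_sphere_def num_nonzero_def m)
    show "\<gamma> * real n \<le> real (card {p \<in> ?B. spread_threshold \<le> \<bar>\<Sum>j<n. signed_coeff ?\<omega> p j * u' j\<bar>})"
      using card_large_signed_coeff_sum_ge[of ?\<omega> u] h u by simp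
  qed (use \<epsilon>_pos \<rho>_pos \<beta>_pos n_pos in \<open>auto simp: spread_threshold_def\<close>)
  then show ?thesis
    by (simp add: not_spreads_sparse_eq_cancelling_signs card_cartesian_product)
qed

lemma prob_not_spreads_sparse_le:
  fixes x :: real
  assumes x: "0 < x" "x \<le> 1" and m: "m = nat \<lfloor>\<alpha> * real n\<rfloor>"
  shows "measure_pmf.prob (perturbation_law n K)
      {\<omega>. \<not> spreads_sparse (M \<omega>) \<alpha> spread_threshold (\<gamma> * real n / 8)}
    \<le> (1 + x) ^ (4 * n) / x ^ (2 * m + 1) * exp (- (\<gamma> * real n) / 4)"
  unfolding perturbation_law_eq
proof (rule prob_pair_pmf_le_snd,
    rule prob_Pi_pmf_override_le[where B = "{2} \<times> {..<n}"], goal_cases)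
  case (3 y h)
  have "h (1, j) \<in> {-1, 1}" if "j < n" for j
    using 3(2) that by (auto simp: set_Pi_pmf PiE_dflt_def dest!: spec[of _ "1 :: nat"])
  then show ?case
    using prob_not_spreads_sparse_given_le[OF x m, of h "fst y" "snd y"] by simp
qed (use x in auto)

lemma normal_Incomp:
  assumes \<omega>: "\<omega> \<in> set_pmf (perturbation_law n K)"
    and spreads: "spreads_sparse (M \<omega>) \<alpha> spread_threshold (\<gamma> * real n / 8)"
    and u: "column_normal (M \<omega>) i u"
  shows "u \<in> Incomp n \<alpha> \<nu>"
proof (rule column_normal_Incomp[OF M_carrier u spreads])
  show "l2_norm ((M \<omega>)\<^sup>T *\<^sub>v y) \<le> 3 * l2_norm y" if "y \<in> carrier_vec n" for y
    using l2_norm_M_mult_le[OF \<omega>] that by (intro l2_norm_mult_transpose_le[OF M_carrier]) auto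
  show "0 \<le> spread_threshold"
    using \<epsilon>_pos \<rho>_pos \<beta>_pos by (simp add: spread_threshold_def)
  have "(3 * \<nu>)\<^sup>2 < \<gamma> * real n / 16 * spread_threshold\<^sup>2"
    using \<nu>_small \<rho>_pos n_pos
    by (simp add: spread_threshold_def power_mult_distrib power_divide field_simps)
  also have "\<dots> \<le> (\<gamma> * real n / 8 - 1) * spread_threshold\<^sup>2"
    using \<gamma>_n by (intro mult_right_mono) auto
  finally show "(3 * \<nu>)\<^sup>2 < (\<gamma> * real n / 8 - 1) * spread_threshold\<^sup>2" .
qed simp

definition few_heavy_rows :: "perturbation_input \<Rightarrow> bool" where
  "few_heavy_rows = (\<lambda>(\<eta>, J, X).
    (\<Sum>j\<in>heavy_rows n L J. real (row_count n J j)) \<le> \<alpha> * real n / 2)"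

lemma prob_not_few_heavy_rows_le:
  "measure_pmf.prob (perturbation_law n K) {\<omega>. \<not> few_heavy_rows \<omega>}
    \<le> 2 / \<alpha> * (exp (3 * real K) / 2 ^ L)"
  unfolding perturbation_law_eq
proof (rule prob_pair_pmf_le_fst, rule prob_pair_pmf_le_snd)
  fix \<eta> X
  have "measure_pmf.prob (random_subsets n K)
      {J. (J, X) \<in> {y. (\<eta>, y) \<in> {\<omega>. \<not> few_heavy_rows \<omega>}}}
    \<le> measure_pmf.prob (random_subsets n K)
      {J. \<alpha> * real n / 2 \<le> (\<Sum>j\<in>heavy_rows n L J. real (row_count n J j))}"
    by (intro measure_pmf.finite_measure_mono) (auto simp: few_heavy_rows_def)
  also have "\<dots> \<le> real n * (exp (3 * real K) / 2 ^ L) / (\<alpha> * real n / 2)"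
    using \<alpha>_pos n_pos by (intro prob_heavy_rows_weight_le K_pos K_le_n) simp
  also have "\<dots> = 2 / \<alpha> * (exp (3 * real K) / 2 ^ L)"
    using n_pos by (simp add: field_simps)
  finally show "measure_pmf.prob (random_subsets n K)
      {J. (J, X) \<in> {y. (\<eta>, y) \<in> {\<omega>. \<not> few_heavy_rows \<omega>}}} \<le> 2 / \<alpha> * (exp (3 * real K) / 2 ^ L)" .
qed (use \<alpha>_pos in auto)

subsection \<open>Images of incompressible vectors\<close>

lemma small_column_if_large_coordinate:
  assumes law: "(\<eta>, J, X) \<in> set_pmf (perturbation_law n K)"
    and spreads: "spreads_sparse (M (\<eta>, J, X)) \<alpha> spread_threshold (\<gamma> * real n / 8)"
    and few: "few_heavy_rows (\<eta>, J, X)"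
    and v: "v \<in> carrier_vec n" "l2_norm (M (\<eta>, J, X) *\<^sub>v v) < threshold * (\<epsilon> * threshold / real L)"
    and i: "i < n" "threshold \<le> \<bar>v $ i\<bar>" and untruncated: "\<And>j. j \<in> J i \<Longrightarrow> row_count n J j \<le> L"
  shows "small_column i (\<eta>, J, X)"
proof -
  let ?\<omega> = "(\<eta>, J, X)"
  define u where "u = normal i ?\<omega>"
  have u: "column_normal (M ?\<omega>) i u"
    unfolding u_def by (rule column_normal_normal[OF i(1) untruncated])
  have large: "\<alpha> * real n < real (card {j. j < n \<and> threshold \<le> \<bar>u $ j\<bar>})"
    unfolding threshold_def
    by (rule Incomp_many_large_coordinates[OF normal_Incomp[OF law spreads u] \<nu>_pos \<nu>_less])
  have "{j. j < n \<and> threshold \<le> \<bar>u $ j\<bar>} \<subseteq> light_support i ?\<omega> \<union> heavy_rows n L J"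
    using row_count_empty[OF i(1), of J]
    by (auto simp: light_support_def heavy_rows_def u_def not_less)
  then have "card {j. j < n \<and> threshold \<le> \<bar>u $ j\<bar>} \<le> card (light_support i ?\<omega> \<union> heavy_rows n L J)"
    by (intro card_mono) (simp_all add: light_support_def heavy_rows_def)
  also have "\<dots> \<le> card (light_support i ?\<omega>) + card (heavy_rows n L J)" by (rule card_Un_le)
  finally have "real (card {j. j < n \<and> threshold \<le> \<bar>u $ j\<bar>})
      \<le> real (card (light_support i ?\<omega>)) + real (card (heavy_rows n L J))" by linarith
  moreover have "real (card (heavy_rows n L J)) \<le> \<alpha> * real n / 2"
    using card_heavy_rows_le[of L n J] L_pos few by (simp add: few_heavy_rows_def)
  ultimately have light: "\<alpha> * real n / 2 \<le> real (card (light_support i ?\<omega>))"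
    using large by linarith
  have "threshold * \<bar>col (M ?\<omega>) i \<bullet> u\<bar> \<le> \<bar>v $ i\<bar> * \<bar>col (M ?\<omega>) i \<bullet> u\<bar>"
    using i(2) by (rule mult_right_mono) simp
  also have "\<dots> < threshold * (\<epsilon> * threshold / real L)"
    using column_normal_bound[OF M_carrier v(1) i(1) u] v(2) by (rule le_less_trans)
  finally show ?thesis
    using light threshold_pos unfolding small_column_def u_def
    by (simp only: mult_less_cancel_left_pos)
qed

lemma many_small_columns:
  assumes law: "\<omega> \<in> set_pmf (perturbation_law n K)"
    and spreads: "spreads_sparse (M \<omega>) \<alpha> spread_threshold (\<gamma> * real n / 8)"
    and few: "few_heavy_rows \<omega>"
    and v: "v \<in> Incomp n \<alpha> \<nu>" "l2_norm (M \<omega> *\<^sub>v v) < threshold * (\<epsilon> * threshold / real L)"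
  shows "\<alpha> * real n / 2 \<le> real (card {i \<in> {..<n}. small_column i \<omega>})"
proof -
  obtain \<eta> J X where \<omega>: "\<omega> = (\<eta>, J, X)" by (cases \<omega>) auto
  define Truncated where "Truncated = {i. i < n \<and> (\<exists>j\<in>J i. L < row_count n J j)}"
  have vc: "v \<in> carrier_vec n" using v(1) by (simp add: Incomp_def unit_sphere_def)
  have large: "\<alpha> * real n < real (card {i. i < n \<and> threshold \<le> \<bar>v $ i\<bar>})"
    unfolding threshold_def by (rule Incomp_many_large_coordinates[OF v(1) \<nu>_pos \<nu>_less])
  have "card {i. i < n \<and> threshold \<le> \<bar>v $ i\<bar>} \<le> card ({i \<in> {..<n}. small_column i \<omega>} \<union> Truncated)"
    using small_column_if_large_coordinate[of \<eta> J X v] law spreads few v(2) vc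
    by (intro card_mono) (auto simp: \<omega> Truncated_def not_less)
  also have "\<dots> \<le> card {i \<in> {..<n}. small_column i \<omega>} + card Truncated" by (rule card_Un_le)
  finally have "real (card {i. i < n \<and> threshold \<le> \<bar>v $ i\<bar>})
      \<le> real (card {i \<in> {..<n}. small_column i \<omega>}) + real (card Truncated)" by linarith
  moreover have "real (card Truncated) \<le> \<alpha> * real n / 2"
    using card_columns_meeting_heavy_rows_le[of n J L] few
      set_pmf_perturbation_law(2)[OF law[unfolded \<omega>] K_le_n]
    by (simp add: \<omega> Truncated_def few_heavy_rows_def)
  ultimately show ?thesis using large by linarith
qed

lemma prob_small_image_le:
  fixes x :: real
  assumes x: "0 < x" "x \<le> 1" and m: "m = nat \<lfloor>\<alpha> * real n\<rfloor>"
  shows "measure_pmf.prob (perturbation_law n K)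
      {\<omega>. \<exists>v\<in>Incomp n \<alpha> \<nu>. l2_norm (M \<omega> *\<^sub>v v) < threshold * (\<epsilon> * threshold / real L)}
    \<le> (1 + x) ^ (4 * n) / x ^ (2 * m + 1) * exp (- (\<gamma> * real n) / 4)
      + 2 / \<alpha> * (exp (3 * real K) / 2 ^ L)
      + 2 / \<alpha> * (8 / (\<alpha> * real K) + 2 / sqrt (\<alpha> * real K))"
    (is "?prob {\<omega>. ?small \<omega>} \<le> ?sparse + ?heavy + 2 / \<alpha> * ?column")
proof -
  define NotSpread where
    "NotSpread = {\<omega>. \<not> spreads_sparse (M \<omega>) \<alpha> spread_threshold (\<gamma> * real n / 8)}"
  define Heavy where "Heavy = {\<omega>. \<not> few_heavy_rows \<omega>}"
  define ManySmall where
    "ManySmall = {\<omega>. \<alpha> * real n / 2 \<le> real (card {i \<in> {..<n}. small_column i \<omega>})}"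
  have "?prob {\<omega>. ?small \<omega>} = ?prob ({\<omega>. ?small \<omega>} \<inter> set_pmf (perturbation_law n K))"
    by (simp add: measure_Int_set_pmf)
  also have "\<dots> \<le> ?prob (NotSpread \<union> Heavy \<union> ManySmall)"
    using many_small_columns
    by (intro measure_pmf.finite_measure_mono) (auto simp: NotSpread_def Heavy_def ManySmall_def)
  also have "\<dots> \<le> ?prob NotSpread + ?prob Heavy + ?prob ManySmall"
    by (intro order_trans[OF measure_Un_le] add_right_mono measure_Un_le) auto
  also have "\<dots> \<le> ?sparse + ?heavy + 2 / \<alpha> * ?column"
  proof (intro add_mono)
    show "?prob NotSpread \<le> ?sparse"
      unfolding NotSpread_def by (rule prob_not_spreads_sparse_le[OF x m])
    show "?prob Heavy \<le> ?heavy" unfolding Heavy_def by (rule prob_not_few_heavy_rows_le)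
    have "?prob ManySmall \<le> real (card {..<n}) * ?column / (\<alpha> * real n / 2)"
      unfolding ManySmall_def using \<alpha>_pos n_pos
      by (intro prob_many_events_le prob_small_column_le) auto
    also have "real (card {..<n}) * q / (\<alpha> * real n / 2) = 2 / \<alpha> * q" for q
      using n_pos by (simp add: field_simps)
    finally show "?prob ManySmall \<le> 2 / \<alpha> * ?column" .
  qed
  finally show ?thesis .
qed

end

subsection \<open>The choice of parameters\<close>

lemma exp_minus_le_inverse:
  fixes t :: real
  assumes "0 < t"
  shows "exp (- t) \<le> 1 / t"
proof -
  have "t \<le> exp t" using exp_ge_add_one_self[of t] by linarith
  then show ?thesis using assms by (simp add: exp_minus field_simps)
qed

lemma power_quotient_le_exp:
  fixes \<alpha> \<gamma> :: real
  assumes \<gamma>: "0 < \<gamma>" "\<gamma> < 1" and \<alpha>: "1 \<le> \<alpha> * real n" "\<alpha> < \<gamma> / (60 * ln (40 / \<gamma>))"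
    and m: "m = nat \<lfloor>\<alpha> * real n\<rfloor>"
  shows "(1 + \<gamma> / 40) ^ (4 * n) / (\<gamma> / 40) ^ (2 * m + 1) * exp (- (\<gamma> * real n) / 4)
    \<le> exp (- (\<gamma> * real n / 10))"
proof -
  define l where "l = ln (40 / \<gamma>)"
  have l: "0 < l" using \<gamma> by (simp add: l_def)
  have x: "\<gamma> / 40 = exp (- l)" using \<gamma> by (simp add: l_def exp_minus)
  have "(1 + \<gamma> / 40) ^ (4 * n) / (\<gamma> / 40) ^ (2 * m + 1) * exp (- (\<gamma> * real n) / 4)
      \<le> exp (\<gamma> / 40) ^ (4 * n) / (\<gamma> / 40) ^ (2 * m + 1) * exp (- (\<gamma> * real n) / 4)"
    using \<gamma> by (intro mult_right_mono divide_right_mono power_mono exp_ge_add_one_self) auto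
  also have "\<dots> = exp (\<gamma> * real n / 10 + real (2 * m + 1) * l - \<gamma> * real n / 4)"
    unfolding x exp_of_nat_mult[symmetric]
    by (simp only: exp_diff[symmetric] exp_add[symmetric]) (simp add: x[symmetric] algebra_simps)
  also have "\<dots> \<le> exp (- (\<gamma> * real n / 10))"
  proof -
    have "real m \<le> \<alpha> * real n" using \<alpha>(1) by (simp add: m)
    then have "real (2 * m + 1) * l \<le> 3 * (\<alpha> * real n) * l"
      using \<alpha>(1) l by (intro mult_right_mono) auto
    also have "\<dots> = 3 * l * \<alpha> * real n" by simp
    also have "\<dots> \<le> \<gamma> / 20 * real n"
      using \<alpha>(2) l by (intro mult_right_mono) (simp_all add: l_def[symmetric] field_simps)
    finally show ?thesis by simp
  qed
  finally show ?thesis .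
qed

lemma exp_divide_two_power_le:
  assumes "1 \<le> K" "5 * K \<le> L"
  shows "exp (3 * real K) / 2 ^ L \<le> 3 / real K"
proof -
  have "5 * real K * (2 / 3) \<le> real L * ln 2"
    using assms ln2_ge_two_thirds by (intro mult_mono) auto
  moreover have "exp (3 * real K) / 2 ^ L = exp (3 * real K - real L * ln 2)"
    by (simp add: exp_diff exp_of_nat_mult)
  ultimately have "exp (3 * real K) / 2 ^ L \<le> exp (- (real K / 3))" by simp
  also have "\<dots> \<le> 1 / (real K / 3)" using assms by (intro exp_minus_le_inverse) simp
  finally show ?thesis by simp
qed

lemma ex_incompressibility_constant:
  fixes \<beta> \<gamma> \<rho> :: real
  assumes "0 < \<beta>" "0 < \<gamma>" "0 < \<rho>"
  shows "\<exists>a>0. a \<le> 1 \<and> 144 * a\<^sup>2 * \<rho>\<^sup>2 < \<beta>\<^sup>2 * \<gamma>"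
proof (intro exI conjI)
  let ?a = "min 1 (\<beta> * sqrt \<gamma> / (13 * \<rho>))"
  show "0 < ?a" "?a \<le> 1" using assms by auto
  have "?a * \<rho> \<le> \<beta> * sqrt \<gamma> / (13 * \<rho>) * \<rho>" using assms by (intro mult_right_mono) auto
  also have "\<dots> = \<beta> * sqrt \<gamma> / 13" using assms by simp
  finally have "(?a * \<rho>)\<^sup>2 \<le> (\<beta> * sqrt \<gamma> / 13)\<^sup>2"
    using assms \<open>0 < ?a\<close> by (intro power_mono) auto
  also have "\<dots> = \<beta>\<^sup>2 * \<gamma> / 169" using assms by (simp add: power_mult_distrib power_divide)
  finally have "144 * (?a\<^sup>2 * \<rho>\<^sup>2) \<le> 144 / 169 * (\<beta>\<^sup>2 * \<gamma>)"
    unfolding power_mult_distrib by linarith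
  also have "\<dots> < \<beta>\<^sup>2 * \<gamma>" using assms by simp
  finally show "144 * ?a\<^sup>2 * \<rho>\<^sup>2 < \<beta>\<^sup>2 * \<gamma>" by (simp add: mult.assoc)
qed

locale perturbation_parameters =
  fixes \<beta> \<gamma> \<rho> a \<delta> \<epsilon> \<alpha> :: real and K L n :: nat and A V :: "real Matrix.mat"
  assumes \<beta>: "0 < \<beta>" and \<gamma>: "0 < \<gamma>" "\<gamma> < 1" and \<rho>: "0 < \<rho>"
    and a: "0 < a" "a \<le> 1" "144 * a\<^sup>2 * \<rho>\<^sup>2 < \<beta>\<^sup>2 * \<gamma>"
    and \<delta>: "0 < \<delta>" "\<delta> < 1" and \<epsilon>: "0 < \<epsilon>" "\<epsilon> < 1"
    and \<alpha>: "0 < \<alpha>" "\<alpha> < 1" "\<alpha> < \<gamma> / (60 * ln (40 / \<gamma>))"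
    and K_eq: "K = nat \<lceil>4096 / (\<delta>\<^sup>2 * \<alpha> ^ 3)\<rceil>" and L_eq: "L = nat \<lceil>2 * exp 1 * real K\<rceil>"
    and n_ge: "8192 / \<gamma> / (\<delta> ^ 5 * \<alpha> ^ 9) \<le> real n"
    and A: "A \<in> carrier_mat n n" "spectral_norm A = 1" and V: "pattern_matrix n \<alpha> \<beta> \<gamma> \<rho> V"
begin

lemma K_bounds: "4096 \<le> real K * (\<delta>\<^sup>2 * \<alpha> ^ 3)" "real K * (\<delta>\<^sup>2 * \<alpha> ^ 3) \<le> 8192"
proof -
  define d where "d = \<delta>\<^sup>2 * \<alpha> ^ 3"
  have d: "0 < d" "d \<le> 1" using \<delta> \<alpha> by (auto simp: d_def intro!: mult_le_one power_le_one)
  have "4096 / d \<le> real K" "real K \<le> 4096 / d + 1"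
    using d of_int_ceiling_le_add_one[of "4096 / d"] by (auto simp: K_eq d_def[symmetric])
  then show "4096 \<le> real K * (\<delta>\<^sup>2 * \<alpha> ^ 3)" "real K * (\<delta>\<^sup>2 * \<alpha> ^ 3) \<le> 8192"
    using d unfolding d_def[symmetric] by (simp_all add: field_simps)
qed

lemma K_ge_one: "1 \<le> K"
  using K_bounds(1) by (cases K) auto

lemma L_bounds: "5 * K \<le> L" "L \<le> 7 * K"
proof -
  have "2 * exp 1 * real K \<le> real L" "real L \<le> 2 * exp 1 * real K + 1"
    using of_int_ceiling_le_add_one[of "2 * exp 1 * real K"] by (auto simp: L_eq)
  moreover have "5 * real K \<le> 2 * exp 1 * real K" "2 * exp 1 * real K \<le> 6 * real K"
    using exp_lower_Taylor_quadratic[of 1] e_less_272 by (intro mult_right_mono; simp)+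
  ultimately show "5 * K \<le> L" "L \<le> 7 * K" using K_ge_one by linarith+
qed

lemma n_bounds: "8192 \<le> \<gamma> * real n * (\<delta> * \<alpha>)" "8192 \<le> real n * (\<delta>\<^sup>2 * \<alpha> ^ 3)"
proof -
  have "\<delta> ^ 5 * \<alpha> ^ 9 \<le> \<delta> ^ 1 * \<alpha> ^ 1" "\<delta> ^ 5 * \<alpha> ^ 9 \<le> \<delta> ^ 2 * \<alpha> ^ 3"
    using \<delta> \<alpha> by (intro mult_mono power_decreasing; simp)+
  then have powers: "\<delta> ^ 5 * \<alpha> ^ 9 \<le> \<delta> * \<alpha>" "\<delta> ^ 5 * \<alpha> ^ 9 \<le> \<delta>\<^sup>2 * \<alpha> ^ 3" by simp_all
  have "\<gamma> * real n * (\<delta> ^ 5 * \<alpha> ^ 9) \<le> \<gamma> * real n * (\<delta> * \<alpha>)"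
    using \<gamma> by (intro mult_left_mono powers) simp
  moreover have "\<gamma> * real n * (\<delta> ^ 5 * \<alpha> ^ 9) \<le> 1 * real n * (\<delta>\<^sup>2 * \<alpha> ^ 3)"
    using \<gamma> \<delta> \<alpha> by (intro mult_mono powers mult_right_mono) auto
  moreover have "8192 \<le> \<gamma> * real n * (\<delta> ^ 5 * \<alpha> ^ 9)"
    using n_ge \<gamma> \<delta> \<alpha> by (simp add: field_simps)
  ultimately show "8192 \<le> \<gamma> * real n * (\<delta> * \<alpha>)" "8192 \<le> real n * (\<delta>\<^sup>2 * \<alpha> ^ 3)" by linarith+
qed

lemma K_le_dim: "K \<le> n"
proof -
  have "real K * (\<delta>\<^sup>2 * \<alpha> ^ 3) \<le> real n * (\<delta>\<^sup>2 * \<alpha> ^ 3)" using K_bounds(2) n_bounds(2) by linarith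
  then show ?thesis using \<delta> \<alpha> by simp
qed

lemma \<gamma>_n_\<delta>_ge: "8192 \<le> \<gamma> * real n * \<delta>"
proof -
  have "\<gamma> * real n * (\<delta> * \<alpha>) \<le> \<gamma> * real n * \<delta>"
    using \<gamma> \<delta> \<alpha> by (intro mult_left_mono) (auto simp: mult_left_le)
  then show ?thesis using n_bounds(1) by linarith
qed

lemma \<gamma>_n_ge: "8192 \<le> \<gamma> * real n"
proof -
  have "\<gamma> * real n * \<delta> \<le> \<gamma> * real n * 1" using \<gamma> \<delta> by (intro mult_left_mono) auto
  then show ?thesis using \<gamma>_n_\<delta>_ge by linarith
qed

lemma \<alpha>_n_ge: "1 \<le> \<alpha> * real n"
proof -
  have "\<gamma> * real n * (\<delta> * \<alpha>) = (\<gamma> * \<delta>) * (\<alpha> * real n)" by simp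
  also have "\<dots> \<le> 1 * (\<alpha> * real n)"
    using \<gamma> \<delta> \<alpha> by (intro mult_right_mono mult_le_one) auto
  finally show ?thesis using n_bounds(1) by linarith
qed

sublocale perturbation_model n K L A V \<rho> \<epsilon> \<alpha> \<beta> \<gamma> "a * \<epsilon>"
proof
  show "16 \<le> \<gamma> * real n" using \<gamma>_n_ge by simp
  show "a * \<epsilon> < 2" using mult_le_one[of a \<epsilon>] a \<epsilon> by simp
  show "144 * (a * \<epsilon>)\<^sup>2 * \<rho>\<^sup>2 < \<epsilon>\<^sup>2 * \<beta>\<^sup>2 * \<gamma>"
    using mult_strict_left_mono[OF a(3), of "\<epsilon>\<^sup>2"] \<epsilon> by (simp add: power_mult_distrib mult_ac)
qed (use \<beta> \<rho> a \<epsilon> \<alpha> A V K_ge_one K_le_dim L_bounds in auto)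

lemma sparse_term_le:
  assumes "m = nat \<lfloor>\<alpha> * real n\<rfloor>"
  shows "(1 + \<gamma> / 40) ^ (4 * n) / (\<gamma> / 40) ^ (2 * m + 1) * exp (- (\<gamma> * real n) / 4) \<le> \<delta> / 8"
proof -
  have "(1 + \<gamma> / 40) ^ (4 * n) / (\<gamma> / 40) ^ (2 * m + 1) * exp (- (\<gamma> * real n) / 4)
      \<le> exp (- (\<gamma> * real n / 10))"
    by (rule power_quotient_le_exp[OF \<gamma> \<alpha>_n_ge \<alpha>(3) assms])
  also have "\<dots> \<le> 1 / (\<gamma> * real n / 10)" using \<gamma>_n_ge by (intro exp_minus_le_inverse) simp
  also have "\<dots> \<le> \<delta> / 8" using \<gamma>_n_ge \<gamma>_n_\<delta>_ge by (simp add: field_simps)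
  finally show ?thesis .
qed

lemma heavy_term_le: "2 / \<alpha> * (exp (3 * real K) / 2 ^ L) \<le> \<delta> / 8"
proof -
  have "\<delta>\<^sup>2 * \<alpha> ^ 3 \<le> \<delta> ^ 1 * \<alpha> ^ 1" using \<delta> \<alpha> by (intro mult_mono power_decreasing) auto
  then have "4096 \<le> real K * (\<delta> * \<alpha>)"
    using K_bounds(1) mult_left_mono[of "\<delta>\<^sup>2 * \<alpha> ^ 3" "\<delta> * \<alpha>" "real K"] by simp
  then have "2 / \<alpha> * (3 / real K) \<le> \<delta> / 8"
    using \<alpha> K_pos by (simp add: field_simps)
  moreover have "2 / \<alpha> * (exp (3 * real K) / 2 ^ L) \<le> 2 / \<alpha> * (3 / real K)"
    using exp_divide_two_power_le[OF K_pos L_bounds(1)] \<alpha> by (intro mult_left_mono) auto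
  ultimately show ?thesis by linarith
qed

lemma column_term_le: "2 / \<alpha> * (8 / (\<alpha> * real K) + 2 / sqrt (\<alpha> * real K)) \<le> \<delta> / 4"
proof -
  define q where "q = sqrt (\<alpha> * real K)"
  have "(64 / (\<delta> * \<alpha>))\<^sup>2 \<le> \<alpha> * real K"
    using K_bounds(1) \<delta> \<alpha>
    by (simp add: power_divide power_mult_distrib field_simps power2_eq_square power3_eq_cube)
  then have q: "64 / (\<delta> * \<alpha>) \<le> q" unfolding q_def by (rule real_le_rsqrt)
  have "64 \<le> 64 / (\<delta> * \<alpha>)" using \<delta> \<alpha> mult_le_one[of \<delta> \<alpha>] by (simp add: field_simps)
  then have "64 \<le> q" using q by simp
  have q_inverse: "1 / q \<le> \<delta> * \<alpha> / 64"
    using q \<open>64 \<le> q\<close> \<delta> \<alpha> by (simp add: field_simps)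
  have "8 / (\<alpha> * real K) = 8 / q * (1 / q)" using \<alpha> by (simp add: q_def)
  also have "\<dots> \<le> 1 * (\<delta> * \<alpha> / 64)" using \<open>64 \<le> q\<close> q_inverse by (intro mult_mono) auto
  finally have "8 / (\<alpha> * real K) + 2 / q \<le> 3 * (\<delta> * \<alpha> / 64)" using q_inverse by simp
  then have "2 / \<alpha> * (8 / (\<alpha> * real K) + 2 / q) \<le> 2 / \<alpha> * (3 * (\<delta> * \<alpha> / 64))"
    using \<alpha> by (intro mult_left_mono) auto
  also have "\<dots> \<le> \<delta> / 4" using \<alpha> \<delta> by simp
  finally show ?thesis by (simp add: q_def)
qed

lemma lower_bound_le_threshold:
  "a\<^sup>2 / 229376 * \<epsilon> ^ 3 * \<delta>\<^sup>2 * \<alpha> ^ 3 / real n \<le> threshold * (\<epsilon> * threshold / real L)"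
proof -
  have "real L * (\<delta>\<^sup>2 * \<alpha> ^ 3) \<le> 7 * (real K * (\<delta>\<^sup>2 * \<alpha> ^ 3))"
    using L_bounds(2) \<delta> \<alpha> by (simp add: mult.assoc[symmetric] mult_right_mono)
  then have "real L * (\<delta>\<^sup>2 * \<alpha> ^ 3) \<le> 57344" using K_bounds(2) by simp
  then have "\<delta>\<^sup>2 * \<alpha> ^ 3 / 57344 \<le> 1 / real L" using L_pos by (simp add: field_simps)
  then have "a\<^sup>2 * \<epsilon> ^ 3 / (4 * real n) * (\<delta>\<^sup>2 * \<alpha> ^ 3 / 57344)
      \<le> a\<^sup>2 * \<epsilon> ^ 3 / (4 * real n) * (1 / real L)"
    using \<epsilon> by (intro mult_left_mono) auto
  also have "\<dots> = threshold * (\<epsilon> * threshold / real L)"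
    unfolding threshold_def by (simp add: power2_eq_square power3_eq_cube mult_ac)
  finally show ?thesis by simp
qed

lemma prob_infimum_Incomp_ge:
  "1 - \<delta> / 2 \<le> measure_pmf.prob (perturbation_law n K)
    {\<omega>. ereal (a\<^sup>2 / 229376 * \<epsilon> ^ 3 * \<delta>\<^sup>2 * \<alpha> ^ 3 / real n)
      \<le> (INF v \<in> Incomp n \<alpha> (a * \<epsilon>). ereal (l2_norm (M \<omega> *\<^sub>v v)))}"
    (is "_ \<le> measure_pmf.prob _ ?E")
proof -
  let ?prob = "measure_pmf.prob (perturbation_law n K)"
  define F where
    "F = {\<omega>. \<exists>v\<in>Incomp n \<alpha> (a * \<epsilon>). l2_norm (M \<omega> *\<^sub>v v) < threshold * (\<epsilon> * threshold / real L)}"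
  have "?prob F \<le> \<delta> / 8 + \<delta> / 8 + \<delta> / 4"
    unfolding F_def using \<gamma>
    by (intro order_trans[OF prob_small_image_le[of "\<gamma> / 40"]] add_mono
        sparse_term_le heavy_term_le column_term_le) auto
  moreover have "?prob (- F) = 1 - ?prob F"
    using measure_pmf.prob_compl[of F "perturbation_law n K"] by (simp add: Compl_eq_Diff_UNIV)
  moreover have "- F \<subseteq> ?E"
    using lower_bound_le_threshold by (force simp: F_def le_INF_iff not_less)
  then have "?prob (- F) \<le> ?prob ?E" by (intro measure_pmf.finite_measure_mono) auto
  ultimately show ?thesis by simp
qed

end

theorem theorem7p8:
  fixes \<beta> \<gamma> \<rho> :: real
  assumes "0 < \<beta>" "\<beta> < 1" "0 < \<gamma>" "\<gamma> < 1" "\<rho> > 0"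
  shows "\<exists>a1 a2 c1 c2 c3 :: real. a1 > 0 \<and> a2 > 0 \<and> c1 > 0 \<and> c2 > 0 \<and> c3 > 0 \<and>
    (\<forall>(\<delta> :: real) (\<epsilon> :: real) (\<alpha> :: real) (\<nu> :: real) (K :: nat) (L :: nat) (n :: nat)
       (A :: real Matrix.mat) (V :: real Matrix.mat).
       0 < \<delta> \<longrightarrow> \<delta> < 1 \<longrightarrow> 0 < \<epsilon> \<longrightarrow> \<epsilon> < 1 \<longrightarrow> 0 < \<alpha> \<longrightarrow> \<alpha> < 1 \<longrightarrow> \<alpha> < a1 \<longrightarrow>
       \<nu> = a2 * \<epsilon> \<longrightarrow>
       K = nat \<lceil>c2 / (\<delta>^2 * \<alpha>^3)\<rceil> \<longrightarrow>
       L = nat \<lceil>2 * exp 1 * real K\<rceil> \<longrightarrow>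
       real n \<ge> c1 / (\<delta>^5 * \<alpha>^9) \<longrightarrow>
       A \<in> carrier_mat n n \<longrightarrow> spectral_norm A = 1 \<longrightarrow>
       pattern_matrix n \<alpha> \<beta> \<gamma> \<rho> V \<longrightarrow>
       measure_pmf.prob (perturbation_law n K)
         {\<omega>. (INF v \<in> Incomp n \<alpha> \<nu>.
                 ereal (l2_norm ((A + \<epsilon> \<cdot>\<^sub>m (R1 n \<rho> V \<omega> + R2 n K L \<omega>)) *\<^sub>v v)))
               \<ge> ereal (c3 * \<epsilon>^3 * \<delta>^2 * \<alpha>^3 / real n)}
         \<ge> 1 - \<delta> / 2)"
proof -
  obtain a where a: "0 < a" "a \<le> 1" "144 * a\<^sup>2 * \<rho>\<^sup>2 < \<beta>\<^sup>2 * \<gamma>"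
    using ex_incompressibility_constant assms by blast
  show ?thesis
  proof (rule exI[of _ "\<gamma> / (60 * ln (40 / \<gamma>))"], rule exI[of _ a], rule exI[of _ "8192 / \<gamma>"],
      rule exI[of _ 4096], rule exI[of _ "a\<^sup>2 / 229376"], intro conjI allI impI, goal_cases)
    case (6 \<delta> \<epsilon> \<alpha> \<nu> K L n A V)
    then interpret perturbation_parameters \<beta> \<gamma> \<rho> a \<delta> \<epsilon> \<alpha> K L n A V
      using assms a by unfold_locales auto
    show ?case using prob_infimum_Incomp_ge unfolding M_def \<open>\<nu> = a * \<epsilon>\<close> by simp
  qed (use assms a in auto)
qed

end
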